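(* Let $g\in H$ be a time-independent force and let $\mathcal{A}_g$ be the global attractor of the 2D periodic Navier-Stokes equations $\frac{du}{dt}+\nu Au+B(u,u)=g$. If $0\in\mathcal{A}_g$, then $g\in E_b$ with $b=\frac{1}{160\ln\beta_3}$, where $\beta_3$ is the constant (depending on $g$) described in the context, and this $E_b$ has the property that $E_b=\bigcup_{n=1}^\infty E_{b,n}$ is of first (Baire) category in the metric space $(\mathcal{F},d)$.
   Context: Fix $L>0$, $\nu>0$, $\Omega=[0,L]^2$, $\kappa_0=2\pi/L$. $H$ is the closure in $[L^2(\Omega)]^2$ of the $\Omega$-periodic $\mathbb{R}^2$-valued trigonometric polynomials $v$ with $\nabla\cdot v=0$ and $\int_\Omega v\,dx=0$; $(\cdot,\cdot)$ and $|\cdot|$ denote the $L^2$ scalar product and norm. Elements of $H$ are written $u(x)=\sum_{k\in\mathbb{Z}^2\setminus\{0\}}\hat u(k)e^{i\kappa_0k\cdot x}$, with $|u|^2=L^2\sum_k|\hat u(k)|^2$. $\mathcal{P}$ is the orthogonal (Helmholtz-Leray) projection of $[L^2(\Omega)]^2$ onto $H$; $A=-\mathcal{P}\Delta$ $(=-\Delta)$ is the Stokes operator, with powers defined spectrally: $\widehat{A^{s}u}(k)=(\kappa_0|k|)^{2s}\hat u(k)$; $B(u,v)=\mathcal{P}((u\cdot\nabla)v)$. The global attractor $\mathcal{A}_g$ is the set of all $u_0\in H$ for which there exists a solution $u(t)$ of $\frac{du}{dt}+\nu Au+B(u,u)=g$ defined for all $t\in\mathbb{R}$ with $u(0)=u_0$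 and $\sup_{t\in\mathbb{R}}|u(t)|<\infty$. For $\sigma>0$, $\mathcal{C}(\sigma)$ is the set of $u\in C^\infty([0,L]^2)\cap H$ for which there is a constant $c_0=c_0(u)$ with $|A^{\alpha/2}u|^2\le c_0e^{\sigma\alpha^2}\nu^2\kappa_0^{2\alpha}$ for all $\alpha\in\mathbb{N}$. The constant $\beta_3>1$ is the constant, depending on $g$, from the previously established result that $0\in\mathcal{A}_g$ implies $g\in\mathcal{C}(\tfrac52\ln\beta_3)$. For $b>0$, $E^bu$ is defined by $\widehat{E^bu}(k)=e^{b[\ln(|k|+e)]^2}\hat u(k)$, $|u|_b:=|E^bu|$, $E_b:=\{u\in H:|u|_b<\infty\}$, and $E_{b,n}:=\{u\in E_b:|u|_b\le n\}$ for integers $n\ge1$. $\mathcal{F}=C^\infty\cap H$ is the space of $\Omega$-periodic $C^\infty$ elements of $H$, with the metric $d(u,v)=\sum_{\alpha=1}^\infty 2^{-\alpha}\frac{|A^{\alpha/2}(u-v)|}{1+|A^{\alpha/2}(u-v)|}$. A set is of first category (meagre) if it is a countable union of nowhere dense sets. *)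

theory Defs
  imports "HOL-Analysis.Analysis"
begin

text \<open>
  An element of the Lebesgue space on the square \<open>\<Omega> = [0,L]\<^sup>2\<close> is represented by any of its
  representatives \<open>real^2 \<Rightarrow> real^2\<close>; values outside \<open>\<Omega>\<close> are irrelevant and equality of
  elements is \<open>L2_eq\<close>.  All sets of such elements below (\<open>H_space\<close>, \<open>attractor\<close>,
  \<open>C_class\<close>, \<open>E_space\<close>, \<open>E_ball\<close>) are closed under \<open>L2_eq\<close>.  The exception is
  \<open>F_space\<close>, whose elements are honest smooth periodic functions on the plane, so that each
  of them is the unique representative of its class in \<open>F_space\<close>.
\<close>

definition Omega :: "real \<Rightarrow> (real^2) set" where
  "Omega L = {x. \<forall>j. 0 \<le> x $ j \<and> x $ j \<le> L}"

definition kappa0 :: "real \<Rightarrow> real" where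
  "kappa0 L = 2 * pi / L"

definition wave :: "int^2 \<Rightarrow> real^2" where
  "wave k = (\<chi> j. real_of_int (k $ j))"

section \<open>The space of square-integrable vector fields\<close>

definition L2_space :: "real \<Rightarrow> (real^2 \<Rightarrow> real^2) set" where
  "L2_space L = {u. u \<in> borel_measurable (lebesgue_on (Omega L)) \<and>
                    integrable (lebesgue_on (Omega L)) (\<lambda>x. (norm (u x))\<^sup>2)}"

definition L2_eq :: "real \<Rightarrow> (real^2 \<Rightarrow> real^2) \<Rightarrow> (real^2 \<Rightarrow> real^2) \<Rightarrow> bool" where
  "L2_eq L u v \<longleftrightarrow> (AE x in lebesgue_on (Omega L). u x = v x)"

definition L2_inner :: "real \<Rightarrow> (real^2 \<Rightarrow> real^2) \<Rightarrow> (real^2 \<Rightarrow> real^2) \<Rightarrow> real" where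
  "L2_inner L u v = integral\<^sup>L (lebesgue_on (Omega L)) (\<lambda>x. u x \<bullet> v x)"

definition L2_norm :: "real \<Rightarrow> (real^2 \<Rightarrow> real^2) \<Rightarrow> real" where
  "L2_norm L u = sqrt (L2_inner L u u)"

section \<open>Periodic and smooth functions\<close>

definition periodic :: "real \<Rightarrow> (real^2 \<Rightarrow> 'a) \<Rightarrow> bool" where
  "periodic L f \<longleftrightarrow> (\<forall>x j. f (x + L *\<^sub>R axis j 1) = f x)"

definition pderiv_at :: "2 \<Rightarrow> (real^2 \<Rightarrow> 'a::real_normed_vector) \<Rightarrow> real^2 \<Rightarrow> 'a" where
  "pderiv_at j f x = frechet_derivative f (at x) (axis j 1)"

primrec C_k :: "nat \<Rightarrow> (real^2 \<Rightarrow> 'a::real_normed_vector) \<Rightarrow> bool" where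
  "C_k 0 f = continuous_on UNIV f"
| "C_k (Suc n) f = ((\<forall>x. f differentiable (at x)) \<and> (\<forall>j. C_k n (pderiv_at j f)))"

definition smooth :: "(real^2 \<Rightarrow> 'a::real_normed_vector) \<Rightarrow> bool" where
  "smooth f \<longleftrightarrow> (\<forall>n. C_k n f)"

definition divergence :: "(real^2 \<Rightarrow> real^2) \<Rightarrow> real^2 \<Rightarrow> real" where
  "divergence v x = (\<Sum>j\<in>UNIV. pderiv_at j v x $ j)"

section \<open>The spaces \<open>H\<close> and \<open>\<F>\<close>\<close>

definition trig_poly :: "real \<Rightarrow> (real^2 \<Rightarrow> real^2) \<Rightarrow> bool" where
  "trig_poly L v \<longleftrightarrow>
     (\<exists>(K :: (int^2) set) (c :: int^2 \<Rightarrow> complex^2). finite K \<and>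
        (\<forall>x j. complex_of_real (v x $ j) =
                 (\<Sum>k\<in>K. c k $ j * exp (\<i> * complex_of_real (kappa0 L * (wave k \<bullet> x))))))"

definition solenoidal_polys :: "real \<Rightarrow> (real^2 \<Rightarrow> real^2) set" where
  "solenoidal_polys L =
     {v. trig_poly L v \<and> (\<forall>x. divergence v x = 0) \<and>
         integral\<^sup>L (lebesgue_on (Omega L)) v = 0}"

definition H_space :: "real \<Rightarrow> (real^2 \<Rightarrow> real^2) set" where
  "H_space L =
     {u \<in> L2_space L. \<forall>e>0. \<exists>v\<in>solenoidal_polys L. L2_norm L (\<lambda>x. u x - v x) < e}"

definition F_space :: "real \<Rightarrow> (real^2 \<Rightarrow> real^2) set" where
  "F_space L = {u \<in> H_space L. smooth u \<and> periodic L u}"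

section \<open>Fourier coefficients and Fourier multipliers\<close>

definition fourier :: "real \<Rightarrow> (real^2 \<Rightarrow> real^2) \<Rightarrow> int^2 \<Rightarrow> complex^2" where
  "fourier L u k =
     (\<chi> j. integral\<^sup>L (lebesgue_on (Omega L))
             (\<lambda>x. complex_of_real (u x $ j) *
                  exp (- (\<i> * complex_of_real (kappa0 L * (wave k \<bullet> x)))))
           / complex_of_real (L\<^sup>2))"

definition is_mult :: "real \<Rightarrow> (int^2 \<Rightarrow> real) \<Rightarrow> (real^2 \<Rightarrow> real^2) \<Rightarrow> (real^2 \<Rightarrow> real^2) \<Rightarrow> bool" where
  "is_mult L m u w \<longleftrightarrow> w \<in> H_space L \<and> (\<forall>k. fourier L w k = m k *\<^sub>R fourier L u k)"

definition mult_dom :: "real \<Rightarrow> (int^2 \<Rightarrow> real) \<Rightarrow> (real^2 \<Rightarrow> real^2) set" where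
  "mult_dom L m = {u \<in> H_space L. \<exists>w. is_mult L m u w}"

text \<open>
  The result of \<open>mult_op\<close> is meaningful on \<open>mult_dom\<close> only, and there it is a
  representative of an element that is unique up to \<open>L2_eq\<close>.
\<close>

definition mult_op :: "real \<Rightarrow> (int^2 \<Rightarrow> real) \<Rightarrow> (real^2 \<Rightarrow> real^2) \<Rightarrow> (real^2 \<Rightarrow> real^2)" where
  "mult_op L m u = (SOME w. is_mult L m u w)"

section \<open>Powers of the Stokes operator\<close>

definition stokes_symbol :: "real \<Rightarrow> real \<Rightarrow> int^2 \<Rightarrow> real" where
  "stokes_symbol L s k = (kappa0 L * norm (wave k)) powr (2 * s)"

definition stokes_dom :: "real \<Rightarrow> real \<Rightarrow> (real^2 \<Rightarrow> real^2) set" where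
  "stokes_dom L s = mult_dom L (stokes_symbol L s)"

definition stokes_pow :: "real \<Rightarrow> real \<Rightarrow> (real^2 \<Rightarrow> real^2) \<Rightarrow> (real^2 \<Rightarrow> real^2)" where
  "stokes_pow L s = mult_op L (stokes_symbol L s)"

section \<open>The bilinear term\<close>

definition leray :: "real \<Rightarrow> (real^2 \<Rightarrow> real^2) \<Rightarrow> (real^2 \<Rightarrow> real^2)" where
  "leray L w =
     (SOME h. h \<in> H_space L \<and> (\<forall>v\<in>H_space L. L2_inner L (\<lambda>x. w x - h x) v = 0))"

text \<open>
  Weak derivative on the torus: the test functions are smooth and periodic, so there is no
  boundary term, and jumps across the boundary of \<open>\<Omega>\<close> are seen.
\<close>

definition is_weak_pderiv :: "real \<Rightarrow> 2 \<Rightarrow> (real^2 \<Rightarrow> real^2) \<Rightarrow> (real^2 \<Rightarrow> real^2) \<Rightarrow> bool" where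
  "is_weak_pderiv L j v w \<longleftrightarrow> w \<in> L2_space L \<and>
     (\<forall>\<phi> :: real^2 \<Rightarrow> real. smooth \<phi> \<and> periodic L \<phi> \<longrightarrow>
        integral\<^sup>L (lebesgue_on (Omega L)) (\<lambda>x. \<phi> x *\<^sub>R w x) =
        - integral\<^sup>L (lebesgue_on (Omega L)) (\<lambda>x. pderiv_at j \<phi> x *\<^sub>R v x))"

definition weak_pderiv :: "real \<Rightarrow> 2 \<Rightarrow> (real^2 \<Rightarrow> real^2) \<Rightarrow> (real^2 \<Rightarrow> real^2)" where
  "weak_pderiv L j v = (SOME w. is_weak_pderiv L j v w)"

definition B_op :: "real \<Rightarrow> (real^2 \<Rightarrow> real^2) \<Rightarrow> (real^2 \<Rightarrow> real^2) \<Rightarrow> (real^2 \<Rightarrow> real^2)" where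
  "B_op L u v = leray L (\<lambda>x. \<Sum>j\<in>UNIV. u x $ j *\<^sub>R weak_pderiv L j v x)"

section \<open>Navier-Stokes equations and the global attractor\<close>

definition has_L2_derivative ::
  "real \<Rightarrow> (real \<Rightarrow> real^2 \<Rightarrow> real^2) \<Rightarrow> (real^2 \<Rightarrow> real^2) \<Rightarrow> real \<Rightarrow> bool" where
  "has_L2_derivative L u w t \<longleftrightarrow>
     ((\<lambda>h. L2_norm L (\<lambda>x. (1 / h) *\<^sub>R (u (t + h) x - u t x) - w x)) \<longlongrightarrow> 0) (at 0)"

text \<open>
  Solutions on the whole time axis.  For time-independent \<open>g\<close> in \<open>H\<close>, weak solutions
  of the two-dimensional periodic problem are analytic in time with values in the domain of the
  Stokes operator at all times after the initial one; hence a solution on the whole axis satisfies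
  the equation at every time as an identity between elements of \<open>H\<close>.
\<close>

definition nse_solution ::
  "real \<Rightarrow> real \<Rightarrow> (real^2 \<Rightarrow> real^2) \<Rightarrow> (real \<Rightarrow> real^2 \<Rightarrow> real^2) \<Rightarrow> bool" where
  "nse_solution L \<nu> g u \<longleftrightarrow>
     (\<forall>t. u t \<in> stokes_dom L 1 \<and>
        (\<exists>u'\<in>H_space L. has_L2_derivative L u u' t \<and>
           L2_eq L (\<lambda>x. u' x + \<nu> *\<^sub>R stokes_pow L 1 (u t) x + B_op L (u t) (u t) x) g))"

definition attractor :: "real \<Rightarrow> real \<Rightarrow> (real^2 \<Rightarrow> real^2) \<Rightarrow> (real^2 \<Rightarrow> real^2) set" where
  "attractor L \<nu> g =
     {u0 \<in> H_space L. \<exists>u. nse_solution L \<nu> g u \<and> L2_eq L (u 0) u0 \<and>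
                          bdd_above (range (\<lambda>t. L2_norm L (u t)))}"

section \<open>The classes \<open>\<C>(\<sigma>)\<close> and \<open>E\<^sub>b\<close>\<close>

definition C_class :: "real \<Rightarrow> real \<Rightarrow> real \<Rightarrow> (real^2 \<Rightarrow> real^2) set" where
  "C_class L \<nu> \<sigma> =
     {u \<in> H_space L. (\<exists>w\<in>F_space L. L2_eq L u w) \<and>
        (\<exists>c0::real. \<forall>\<alpha>::nat. u \<in> stokes_dom L (real \<alpha> / 2) \<and>
           (L2_norm L (stokes_pow L (real \<alpha> / 2) u))\<^sup>2
             \<le> c0 * exp (\<sigma> * (real \<alpha>)\<^sup>2) * \<nu>\<^sup>2 * kappa0 L ^ (2 * \<alpha>))}"

definition E_symbol :: "real \<Rightarrow> int^2 \<Rightarrow> real" where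
  "E_symbol b k = exp (b * (ln (norm (wave k) + exp 1))\<^sup>2)"

text \<open>The extended norm \<open>|E\<^sup>b u|\<close>, infinite when \<open>E\<^sup>b u\<close> is not square-integrable.\<close>

definition E_norm :: "real \<Rightarrow> real \<Rightarrow> (real^2 \<Rightarrow> real^2) \<Rightarrow> ennreal" where
  "E_norm L b u = (if u \<in> mult_dom L (E_symbol b)
                   then ennreal (L2_norm L (mult_op L (E_symbol b) u)) else \<infinity>)"

definition E_space :: "real \<Rightarrow> real \<Rightarrow> (real^2 \<Rightarrow> real^2) set" where
  "E_space L b = {u \<in> H_space L. E_norm L b u < \<infinity>}"

definition E_ball :: "real \<Rightarrow> real \<Rightarrow> nat \<Rightarrow> (real^2 \<Rightarrow> real^2) set" where
  "E_ball L b n = {u \<in> E_space L b. E_norm L b u \<le> of_nat n}"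

section \<open>The metric on \<open>\<F>\<close> and Baire category\<close>

definition F_term :: "real \<Rightarrow> nat \<Rightarrow> (real^2 \<Rightarrow> real^2) \<Rightarrow> (real^2 \<Rightarrow> real^2) \<Rightarrow> real" where
  "F_term L \<alpha> u v = L2_norm L (stokes_pow L (real \<alpha> / 2) (\<lambda>x. u x - v x))"

definition F_dist :: "real \<Rightarrow> (real^2 \<Rightarrow> real^2) \<Rightarrow> (real^2 \<Rightarrow> real^2) \<Rightarrow> real" where
  "F_dist L u v =
     (\<Sum>n. (1/2) ^ Suc n * (F_term L (Suc n) u v / (1 + F_term L (Suc n) u v)))"

definition nowhere_dense_in :: "'a topology \<Rightarrow> 'a set \<Rightarrow> bool" where
  "nowhere_dense_in X S \<longleftrightarrow> S \<subseteq> topspace X \<and> X interior_of (X closure_of S) = {}"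

definition first_category_in :: "'a topology \<Rightarrow> 'a set \<Rightarrow> bool" where
  "first_category_in X S \<longleftrightarrow>
     (\<exists>\<G>. countable \<G> \<and> (\<forall>T\<in>\<G>. nowhere_dense_in X T) \<and> S = \<Union>\<G>)"

end

theory Submission
  imports Defs "HOL-Library.Nat_Bijection"
begin

text \<open>
  For a field \<open>g\<close> in \<open>\<C>(\<sigma>)\<close> every coefficient satisfies
  \<open>|k|\<^sup>\<alpha> |g\<^sub>k| \<le> D exp (\<sigma> \<alpha>\<^sup>2 / 2)\<close> for all \<open>\<alpha>\<close>, and the choice \<open>\<alpha> \<approx> ln |k| / \<sigma>\<close> gives
  \<open>|g\<^sub>k| \<le> D' exp (- (ln |k|)\<^sup>2 / (2 \<sigma>))\<close>.  This beats the square of the symbol of \<open>E\<^sup>b\<close> with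
  \<open>b = 1 / (64 \<sigma>)\<close>, so the Fourier series of \<open>E\<^sup>b g\<close> converges together with all its derivatives.
  Only rapidly convergent series are ever summed, and the inequality
  \<open>|u\<^sub>k| \<le> 2 |u| / L\<close> takes the place of Parseval's identity.

  If \<open>|u|\<^sub>b \<le> n\<close> then \<open>m(k) |u\<^sub>k| \<le> 2 n / L\<close> for all \<open>k\<close>, where \<open>m\<close> is the symbol of \<open>E\<^sup>b\<close>.
  These bounds survive limits in the metric of \<open>\<F>\<close>, which dominates each coefficient.  Some \<open>w\<close> in
  \<open>\<F>\<close> has \<open>m(k) |w\<^sub>k|\<close> unbounded, and \<open>u + t w\<close> tends to \<open>u\<close> as \<open>t\<close> tends to 0, so the closure of
  \<open>E\<^sub>b\<^sub>,\<^sub>n\<close> contains no ball.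
\<close>

section \<open>Square-integrable fields and their Fourier coefficients\<close>

text \<open>What shapes the proof is that \<open>H_space\<close> is a closure and that operator
  values are choices of representatives. An identity between fields is therefore not proved
  pointwise: it is reduced to equality of Fourier coefficients, which determine an element of
  \<open>H_space\<close> up to a null set. In the other direction a field with prescribed
  coefficients is written down as an explicit sum of real modes, and this is how domains of
  multipliers and elements of \<open>F_space\<close> are populated. The square of the symbol has to
  be beaten because one factor is spent on applying \<open>E\<^sup>b\<close>, while the other still
  dominates every power of \<open>|k|\<close> and so leaves a smooth field. The argument has room to
  spare: with the crude bound \<open>(l + 2)\<^sup>2 \<le> 2 * l\<^sup>2 + 8\<close> for the squared
  logarithm it works up to \<open>b = 1 / (8 * \<sigma>)\<close>. In the category argument only
  single coefficients are compared, so no lower bound on the \<open>E\<^sup>b\<close> norm of a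
  perturbed field is ever computed; one coefficient that is too large is enough.\<close>

lemma Omega_eq_cbox: "Omega L = cbox 0 (\<chi> j. L)"
  by (auto simp: Omega_def mem_box_cart)

lemma Omega_lmeasurable [simp]: "Omega L \<in> lmeasurable"
  by (simp add: Omega_eq_cbox)

lemma Omega_sets [simp]: "Omega L \<in> sets lebesgue"
  by (simp add: Omega_eq_cbox)

lemma finite_measure_Omega: "finite_measure (lebesgue_on (Omega L))"
  by (simp add: finite_measure_lebesgue_on)

lemma measure_Omega: "L > 0 \<Longrightarrow> measure (lebesgue_on (Omega L)) (Omega L) = L\<^sup>2"
  by (simp add: measure_restrict_space Omega_eq_cbox content_cbox_cart interval_ne_empty_cart)

lemma integral_const_Omega:
  fixes c :: "'a :: euclidean_space"
  shows "L > 0 \<Longrightarrow> integral\<^sup>L (lebesgue_on (Omega L)) (\<lambda>x. c) = L\<^sup>2 *\<^sub>R c"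
  using measure_Omega[of L] by simp

lemma borel_measurable_lebesgue_on_Omega:
  assumes "continuous_on UNIV f"
  shows "f \<in> borel_measurable (lebesgue_on (Omega L))"
  using assms continuous_on_subset by (intro continuous_imp_measurable_on_sets_lebesgue) auto

lemma integrable_Omega_continuous:
  fixes f :: "real^2 \<Rightarrow> 'b :: euclidean_space"
  assumes "continuous_on UNIV f"
  shows "integrable (lebesgue_on (Omega L)) f"
  unfolding Omega_eq_cbox
  using assms continuous_on_subset by (intro continuous_imp_integrable) auto

text \<open>The parabola is tested at its vertex \<open>t = X / G\<close>. If \<open>G = 0\<close>
  it degenerates to a line, which stays nonnegative only when its slope vanishes.\<close>

lemma square_le_of_quadratic_nonneg:
  fixes F G X :: real
  assumes "\<And>t. 0 \<le> F - 2 * t * X + t\<^sup>2 * G" and "0 \<le> G"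
  shows "X\<^sup>2 \<le> F * G"
proof (cases "G = 0")
  case True
  show ?thesis
  proof (cases "X = 0")
    case False
    \<comment> \<open>This \<open>t\<close> would make the line take the value -1.\<close>
    then show ?thesis
      using assms(1)[of "(F + 1) / (2 * X)"] True by simp
  qed (simp add: True)
next
  case False
  with assms have G: "G > 0" by simp
  have "0 \<le> F - 2 * (X / G) * X + (X / G)\<^sup>2 * G" by (rule assms)
  also have "\<dots> = F - X\<^sup>2 / G"
    using G by (simp add: field_simps power2_eq_square)
  finally show ?thesis using G by (simp add: field_simps)
qed

text \<open>Integrability comes from
  \<open>2 * |f x * g x| \<le> (f x)\<^sup>2 + (g x)\<^sup>2\<close>; the inequality is the
  discriminant condition for the integral of \<open>(f - t g)\<^sup>2\<close> as a quadratic in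
  \<open>t\<close>.\<close>

lemma
  fixes f g :: "'a \<Rightarrow> real"
  assumes f: "f \<in> borel_measurable M" "integrable M (\<lambda>x. (f x)\<^sup>2)"
    and g: "g \<in> borel_measurable M" "integrable M (\<lambda>x. (g x)\<^sup>2)"
  shows integrable_mult_square_integrable: "integrable M (\<lambda>x. f x * g x)"
    and Cauchy_Schwarz_integral:
      "(integral\<^sup>L M (\<lambda>x. f x * g x))\<^sup>2 \<le> integral\<^sup>L M (\<lambda>x. (f x)\<^sup>2) * integral\<^sup>L M (\<lambda>x. (g x)\<^sup>2)"
proof -
  show int: "integrable M (\<lambda>x. f x * g x)"
  proof (rule Bochner_Integration.integrable_bound)
    show "integrable M (\<lambda>x. (f x)\<^sup>2 + (g x)\<^sup>2)" using f g by simp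
    show "AE x in M. norm (f x * g x) \<le> norm ((f x)\<^sup>2 + (g x)\<^sup>2)"
    proof (rule AE_I2)
      fix x
      have "2 * \<bar>f x * g x\<bar> \<le> (f x)\<^sup>2 + (g x)\<^sup>2"
        using sum_squares_bound[of "\<bar>f x\<bar>" "\<bar>g x\<bar>"] by (simp add: abs_mult mult.assoc)
      then show "norm (f x * g x) \<le> norm ((f x)\<^sup>2 + (g x)\<^sup>2)" by simp
    qed
  qed (use f g in measurable)
  show "(integral\<^sup>L M (\<lambda>x. f x * g x))\<^sup>2 \<le> integral\<^sup>L M (\<lambda>x. (f x)\<^sup>2) * integral\<^sup>L M (\<lambda>x. (g x)\<^sup>2)"
  proof (rule square_le_of_quadratic_nonneg)
    fix t
    have "0 \<le> integral\<^sup>L M (\<lambda>x. (f x - t * g x)\<^sup>2)" by simp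
    also have "(\<lambda>x. (f x - t * g x)\<^sup>2) = (\<lambda>x. (f x)\<^sup>2 - 2 * t * (f x * g x) + t\<^sup>2 * (g x)\<^sup>2)"
      by (auto simp: power2_eq_square algebra_simps)
    also have "integral\<^sup>L M \<dots> = integral\<^sup>L M (\<lambda>x. (f x)\<^sup>2) - 2 * t * integral\<^sup>L M (\<lambda>x. f x * g x)
        + t\<^sup>2 * integral\<^sup>L M (\<lambda>x. (g x)\<^sup>2)"
      using f g int by simp
    finally show "0 \<le> integral\<^sup>L M (\<lambda>x. (f x)\<^sup>2) - 2 * t * integral\<^sup>L M (\<lambda>x. f x * g x)
        + t\<^sup>2 * integral\<^sup>L M (\<lambda>x. (g x)\<^sup>2)" .
  qed simp
qed

section \<open>Linear structure and seminorm of the square-integrable fields\<close>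

lemma L2_space_add:
  assumes "u \<in> L2_space L" "v \<in> L2_space L"
  shows "(\<lambda>x. u x + v x) \<in> L2_space L"
proof -
  have [measurable]: "u \<in> borel_measurable (lebesgue_on (Omega L))" "v \<in> borel_measurable (lebesgue_on (Omega L))"
    using assms by (auto simp: L2_space_def)
  have "integrable (lebesgue_on (Omega L)) (\<lambda>x. (norm (u x + v x))\<^sup>2)"
  proof (rule Bochner_Integration.integrable_bound)
    show "integrable (lebesgue_on (Omega L)) (\<lambda>x. 2 * (norm (u x))\<^sup>2 + 2 * (norm (v x))\<^sup>2)"
      using assms by (simp add: L2_space_def)
    show "AE x in lebesgue_on (Omega L). norm ((norm (u x + v x))\<^sup>2) \<le> norm (2 * (norm (u x))\<^sup>2 + 2 * (norm (v x))\<^sup>2)"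
    proof (rule AE_I2)
      fix x
      have "(norm (u x + v x))\<^sup>2 \<le> (norm (u x) + norm (v x))\<^sup>2"
        by (intro power_mono norm_triangle_ineq) simp
      also have "\<dots> \<le> 2 * (norm (u x))\<^sup>2 + 2 * (norm (v x))\<^sup>2"
        using sum_squares_bound[of "norm (u x)" "norm (v x)"] by (simp add: power2_sum)
      finally show "norm ((norm (u x + v x))\<^sup>2) \<le> norm (2 * (norm (u x))\<^sup>2 + 2 * (norm (v x))\<^sup>2)"
        by simp
    qed
  qed measurable
  then show ?thesis by (simp add: L2_space_def)
qed

lemma L2_space_scaleR:
  assumes "u \<in> L2_space L"
  shows "(\<lambda>x. c *\<^sub>R u x) \<in> L2_space L"
  using assms by (auto simp: L2_space_def power_mult_distrib)

lemma L2_space_diff: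
  assumes "u \<in> L2_space L" "v \<in> L2_space L"
  shows "(\<lambda>x. u x - v x) \<in> L2_space L"
  using L2_space_add[OF assms(1) L2_space_scaleR[OF assms(2), of "-1"]] by simp

lemma L2_space_continuous: "continuous_on UNIV u \<Longrightarrow> u \<in> L2_space L"
  by (auto simp: L2_space_def intro!: borel_measurable_lebesgue_on_Omega integrable_Omega_continuous continuous_intros)

lemma integrable_L2_inner:
  assumes "u \<in> L2_space L" "v \<in> L2_space L"
  shows "integrable (lebesgue_on (Omega L)) (\<lambda>x. u x \<bullet> v x)"
proof (rule Bochner_Integration.integrable_bound)
  show "integrable (lebesgue_on (Omega L)) (\<lambda>x. norm (u x) * norm (v x))"
    using assms by (intro integrable_mult_square_integrable) (auto simp: L2_space_def)
  show "(\<lambda>x. u x \<bullet> v x) \<in> borel_measurable (lebesgue_on (Omega L))"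
    using assms by (auto simp: L2_space_def)
qed (auto simp: Cauchy_Schwarz_ineq2)

lemma L2_norm_sq: "(L2_norm L u)\<^sup>2 = integral\<^sup>L (lebesgue_on (Omega L)) (\<lambda>x. (norm (u x))\<^sup>2)"
  by (simp add: L2_norm_def L2_inner_def power2_norm_eq_inner)

lemma L2_norm_nonneg [simp]: "0 \<le> L2_norm L u"
  by (simp add: L2_norm_def L2_inner_def)

lemma L2_Cauchy_Schwarz:
  assumes "u \<in> L2_space L" "v \<in> L2_space L"
  shows "\<bar>L2_inner L u v\<bar> \<le> L2_norm L u * L2_norm L v"
proof -
  have uv: "(\<lambda>x. norm (u x)) \<in> borel_measurable (lebesgue_on (Omega L))"
    "integrable (lebesgue_on (Omega L)) (\<lambda>x. (norm (u x))\<^sup>2)"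
    "(\<lambda>x. norm (v x)) \<in> borel_measurable (lebesgue_on (Omega L))"
    "integrable (lebesgue_on (Omega L)) (\<lambda>x. (norm (v x))\<^sup>2)"
    using assms by (auto simp: L2_space_def)
  have "\<bar>L2_inner L u v\<bar> \<le> integral\<^sup>L (lebesgue_on (Omega L)) (\<lambda>x. norm (u x \<bullet> v x))"
    unfolding L2_inner_def real_norm_def[symmetric] by (rule integral_norm_bound)
  also have "\<dots> \<le> integral\<^sup>L (lebesgue_on (Omega L)) (\<lambda>x. norm (u x) * norm (v x))"
    using integrable_L2_inner[OF assms] integrable_mult_square_integrable[OF uv]
    by (intro integral_mono) (auto simp: Cauchy_Schwarz_ineq2)
  also have "\<dots> \<le> L2_norm L u * L2_norm L v"
  proof (rule power2_le_imp_le)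
    show "(integral\<^sup>L (lebesgue_on (Omega L)) (\<lambda>x. norm (u x) * norm (v x)))\<^sup>2 \<le> (L2_norm L u * L2_norm L v)\<^sup>2"
      using Cauchy_Schwarz_integral[OF uv] by (simp add: power_mult_distrib L2_norm_sq)
  qed simp
  finally show ?thesis .
qed

lemma L2_norm_triangle:
  assumes "u \<in> L2_space L" "v \<in> L2_space L"
  shows "L2_norm L (\<lambda>x. u x + v x) \<le> L2_norm L u + L2_norm L v"
proof (rule power2_le_imp_le)
  have "(L2_norm L (\<lambda>x. u x + v x))\<^sup>2
      = integral\<^sup>L (lebesgue_on (Omega L)) (\<lambda>x. (norm (u x))\<^sup>2 + 2 * (u x \<bullet> v x) + (norm (v x))\<^sup>2)"
    unfolding L2_norm_sq by (simp add: power2_norm_eq_inner algebra_simps inner_commute)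
  also have "\<dots> = (L2_norm L u)\<^sup>2 + 2 * L2_inner L u v + (L2_norm L v)\<^sup>2"
    using assms integrable_L2_inner[OF assms] by (simp add: L2_norm_sq L2_inner_def L2_space_def)
  also have "\<dots> \<le> (L2_norm L u + L2_norm L v)\<^sup>2"
    using L2_Cauchy_Schwarz[OF assms] by (simp add: power2_sum)
  finally show "(L2_norm L (\<lambda>x. u x + v x))\<^sup>2 \<le> (L2_norm L u + L2_norm L v)\<^sup>2" .
qed simp

lemma L2_norm_scaleR: "L2_norm L (\<lambda>x. c *\<^sub>R u x) = \<bar>c\<bar> * L2_norm L u"
proof -
  have "L2_inner L (\<lambda>x. c *\<^sub>R u x) (\<lambda>x. c *\<^sub>R u x) = c\<^sup>2 * L2_inner L u u"
    by (simp add: L2_inner_def power2_eq_square)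
  then show ?thesis by (simp add: L2_norm_def real_sqrt_mult)
qed

lemma L2_norm_minus: "L2_norm L (\<lambda>x. - u x) = L2_norm L u"
  using L2_norm_scaleR[of L "-1" u] by simp

lemma L2_norm_eq_0_iff:
  assumes "u \<in> L2_space L"
  shows "L2_norm L u = 0 \<longleftrightarrow> L2_eq L u (\<lambda>x. 0)"
proof -
  have "L2_norm L u = 0 \<longleftrightarrow> (L2_norm L u)\<^sup>2 = 0" by simp
  also have "\<dots> \<longleftrightarrow> (AE x in lebesgue_on (Omega L). (norm (u x))\<^sup>2 = 0)"
    unfolding L2_norm_sq using assms
    by (intro integral_nonneg_eq_0_iff_AE) (auto simp: L2_space_def)
  finally show ?thesis by (simp add: L2_eq_def)
qed

lemma L2_norm_cong_AE: 
  assumes "L2_eq L u v" "u \<in> L2_space L" "v \<in> L2_space L"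
  shows "L2_norm L u = L2_norm L v"
proof -
  have "L2_inner L u u = L2_inner L v v"
    unfolding L2_inner_def
  proof (rule integral_cong_AE)
    show "AE x in lebesgue_on (Omega L). u x \<bullet> u x = v x \<bullet> v x"
      using assms(1) unfolding L2_eq_def by eventually_elim simp
  qed (use assms in \<open>auto simp: L2_space_def\<close>)
  then show ?thesis by (simp add: L2_norm_def)
qed

lemma L2_inner_diff_left:
  assumes "u \<in> L2_space L" "v \<in> L2_space L" "w \<in> L2_space L"
  shows "L2_inner L u (\<lambda>x. v x - w x) = L2_inner L u v - L2_inner L u w"
  using assms by (simp add: L2_inner_def inner_diff_right integrable_L2_inner)

section \<open>Fourier coefficients: linearity, symmetry and size\<close>

lemma fourier_eq_cis:
  "fourier L u k $ j = integral\<^sup>L (lebesgue_on (Omega L))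
     (\<lambda>x. of_real (u x $ j) * cis (- (kappa0 L * (wave k \<bullet> x)))) / complex_of_real (L\<^sup>2)"
  by (simp add: fourier_def cis_conv_exp)

lemma continuous_on_cis_wave: "continuous_on UNIV (\<lambda>x. cis (c * (w \<bullet> x)))"
  by (intro continuous_intros)

text \<open>On a finite measure \<open>1 + (norm (u x))\<^sup>2\<close> is an integrable majorant.
  The phase is general because it carries a minus sign in coefficients and none in pairings with
  trigonometric polynomials.\<close>

lemma integrable_component_cis:
  assumes "u \<in> L2_space L"
  shows "integrable (lebesgue_on (Omega L)) (\<lambda>x. of_real (u x $ j) * cis (c * (w \<bullet> x)))"
proof (rule Bochner_Integration.integrable_bound)
  interpret finite_measure "lebesgue_on (Omega L)" by (rule finite_measure_Omega)
  show "integrable (lebesgue_on (Omega L)) (\<lambda>x. 1 + (norm (u x))\<^sup>2)"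
    using assms by (simp add: L2_space_def)
  have [measurable]: "u \<in> borel_measurable (lebesgue_on (Omega L))" using assms by (simp add: L2_space_def)
  have [measurable]: "(\<lambda>x. u x $ j) \<in> borel_measurable (lebesgue_on (Omega L))"
    by (intro borel_measurable_continuous_on[where f="\<lambda>y. y $ j"] continuous_intros) measurable
  have [measurable]: "(\<lambda>x. cis (c * (w \<bullet> x))) \<in> borel_measurable (lebesgue_on (Omega L))"
    by (intro borel_measurable_lebesgue_on_Omega continuous_on_cis_wave)
  show "(\<lambda>x. of_real (u x $ j) * cis (c * (w \<bullet> x))) \<in> borel_measurable (lebesgue_on (Omega L))"
    by measurable
  show "AE x in lebesgue_on (Omega L). norm (of_real (u x $ j) * cis (c * (w \<bullet> x))) \<le> norm (1 + (norm (u x))\<^sup>2)"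
  proof (rule AE_I2)
    fix x
    have "\<bar>u x $ j\<bar> \<le> norm (u x)" by (rule component_le_norm_cart)
    also have "\<dots> \<le> 1 + (norm (u x))\<^sup>2" 
      using sum_squares_bound[of 1 "norm (u x)"] norm_ge_zero[of "u x"] by (simp del: norm_ge_zero)
    finally show "norm (of_real (u x $ j) * cis (c * (w \<bullet> x))) \<le> norm (1 + (norm (u x))\<^sup>2)"
      by (simp add: norm_mult)
  qed
qed

lemma integrable_fourier:
  assumes "u \<in> L2_space L"
  shows "integrable (lebesgue_on (Omega L)) (\<lambda>x. of_real (u x $ j) * cis (- (kappa0 L * (wave k \<bullet> x))))"
  using integrable_component_cis[OF assms, of j "- kappa0 L" "wave k"] by simp

lemma fourier_add:
  assumes "u \<in> L2_space L" "v \<in> L2_space L"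
  shows "fourier L (\<lambda>x. u x + v x) k = fourier L u k + fourier L v k"
  using integrable_fourier[OF assms(1)] integrable_fourier[OF assms(2)]
  by (simp add: vec_eq_iff fourier_eq_cis distrib_right add_divide_distrib)

lemma fourier_scaleR: "fourier L (\<lambda>x. c *\<^sub>R u x) k = c *\<^sub>R fourier L u k"
  by (simp add: vec_eq_iff fourier_eq_cis mult.assoc) (simp add: scaleR_conv_of_real)

lemma fourier_minus: "fourier L (\<lambda>x. - u x) k = - fourier L u k"
  using fourier_scaleR[of L "-1" u k] by simp

lemma fourier_diff:
  assumes "u \<in> L2_space L" "v \<in> L2_space L"
  shows "fourier L (\<lambda>x. u x - v x) k = fourier L u k - fourier L v k"
  using fourier_add[OF assms(1) L2_space_scaleR[OF assms(2), of "-1"], of k] by (simp add: fourier_minus)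

lemma fourier_zero [simp]: "fourier L (\<lambda>x. 0) k = 0"
  by (simp add: vec_eq_iff fourier_eq_cis)

lemma fourier_uminus_wave: "fourier L u (- k) $ j = cnj (fourier L u k $ j)"
proof -
  have "wave (- k) = - wave k" by (simp add: wave_def vec_eq_iff)
  then show ?thesis
    by (simp add: fourier_eq_cis cis_cnj flip: Bochner_Integration.integral_cnj)
qed

text \<open>Since the square has area \<open>L\<^sup>2\<close>, the integral of
  \<open>norm (u x)\<close> is at most \<open>L * L2_norm L u\<close>; the normalisation of the
  coefficient then divides by the area.\<close>

lemma norm_fourier_component_le:
  assumes "L > 0" "u \<in> L2_space L"
  shows "norm (fourier L u k $ j) \<le> L2_norm L u / L"
proof -
  interpret finite_measure "lebesgue_on (Omega L)" by (rule finite_measure_Omega)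
  have m: "(\<lambda>x. norm (u x)) \<in> borel_measurable (lebesgue_on (Omega L))"
    "integrable (lebesgue_on (Omega L)) (\<lambda>x. (norm (u x))\<^sup>2)"
    using assms by (auto simp: L2_space_def)
  have i: "integrable (lebesgue_on (Omega L)) (\<lambda>x. norm (u x))"
    using integrable_mult_square_integrable[OF m, of "\<lambda>x. 1"] by simp
  have "norm (integral\<^sup>L (lebesgue_on (Omega L)) (\<lambda>x. of_real (u x $ j) * cis (- (kappa0 L * (wave k \<bullet> x)))))
      \<le> integral\<^sup>L (lebesgue_on (Omega L)) (\<lambda>x. norm (of_real (u x $ j) * cis (- (kappa0 L * (wave k \<bullet> x)))))"
    by (rule integral_norm_bound)
  also have "\<dots> \<le> integral\<^sup>L (lebesgue_on (Omega L)) (\<lambda>x. norm (u x))"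
    using integrable_norm[OF integrable_fourier[OF assms(2), of j k]] i
    by (intro integral_mono) (auto simp: norm_mult component_le_norm_cart)
  also have "\<dots> \<le> L2_norm L u * L"
  proof (rule power2_le_imp_le)
    have "(integral\<^sup>L (lebesgue_on (Omega L)) (\<lambda>x. norm (u x) * 1))\<^sup>2
        \<le> (L2_norm L u)\<^sup>2 * integral\<^sup>L (lebesgue_on (Omega L)) (\<lambda>x. 1\<^sup>2)"
      unfolding L2_norm_sq by (rule Cauchy_Schwarz_integral[OF m]) auto
    also have "integral\<^sup>L (lebesgue_on (Omega L)) (\<lambda>x. 1\<^sup>2 :: real) = L\<^sup>2"
      using integral_const_Omega[OF assms(1), of "1::real"] by simp
    finally show "(integral\<^sup>L (lebesgue_on (Omega L)) (\<lambda>x. norm (u x)))\<^sup>2 \<le> (L2_norm L u * L)\<^sup>2"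
      by (simp add: power_mult_distrib)
  qed (use assms in simp)
  finally have "norm (fourier L u k $ j) \<le> L2_norm L u * L / L\<^sup>2"
    by (simp add: fourier_eq_cis norm_divide norm_power divide_right_mono)
  then show ?thesis
    using assms by (simp add: power2_eq_square)
qed

text \<open>The factor 2 is the price of bounding the Euclidean norm by the sum over the two
  components.\<close>

lemma norm_fourier_le:
  assumes "L > 0" "u \<in> L2_space L"
  shows "norm (fourier L u k) \<le> 2 * L2_norm L u / L"
proof -
  have "norm (fourier L u k) \<le> (\<Sum>j\<in>UNIV. norm (fourier L u k $ j))"
    by (simp add: norm_vec_def L2_set_le_sum)
  also have "\<dots> \<le> (\<Sum>j\<in>(UNIV::2 set). L2_norm L u / L)"
    using assms by (intro sum_mono norm_fourier_component_le)
  finally show ?thesis by simp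
qed

section \<open>Integrals of derivatives of periodic functions\<close>

text \<open>The index type \<open>2\<close> is \<open>\<int>/2\<close>, so \<open>j + 1\<close> is the index other than \<open>j\<close>.\<close>

lemma plus_1_neq [simp]: "(j::2) + 1 \<noteq> j" "j \<noteq> j + 1"
proof -
  have "(1::2) \<noteq> 0" by (rule one_neq_zero)
  then show "j + 1 \<noteq> j" "j \<noteq> j + 1" by (simp_all only: add_cancel_left_right add_cancel_right_right not_False_eq_True)
qed

lemma other_index: "(i::2) \<noteq> j \<longleftrightarrow> i = j + 1"
  by (metis exhaust_2 plus_1_neq(1))

lemma UNIV_2_split: "UNIV = {j, j + 1 :: 2}"
  using other_index by blast

lemma prod_UNIV_2: "prod f UNIV = f j * f (j + 1 :: 2)" for f :: "2 \<Rightarrow> 'a :: comm_monoid_mult"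
  by (subst UNIV_2_split[of j]) simp

text \<open>The coordinate in direction \<open>j\<close> is the first factor for either
  \<open>j\<close>, so that one Fubini argument serves both partial derivatives.\<close>

definition join2 :: "2 \<Rightarrow> real \<times> real \<Rightarrow> real^2" where
  "join2 j p = fst p *\<^sub>R axis j 1 + snd p *\<^sub>R axis (j + 1) 1"

lemma join2_nth [simp]: "join2 j p $ j = fst p" "join2 j p $ (j + 1) = snd p"
  by (auto simp: join2_def axis_def)

lemma all_2_split: "(\<forall>i. P i) \<longleftrightarrow> P j \<and> P (j + 1 :: 2)"
  by (metis other_index)

lemma measurable_join2 [measurable]: "join2 j \<in> borel_measurable (lborel \<Otimes>\<^sub>M lborel)"
proof -
  have "join2 j \<in> borel_measurable borel"
    unfolding join2_def by (intro borel_measurable_continuous_onI continuous_intros)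
  then show ?thesis by (simp add: lborel_prod)
qed

text \<open>Lebesgue measure is determined by its values on boxes, and \<open>join2 j\<close> pulls
  a box back to a product of two intervals.\<close>

lemma lborel_join2: "lborel = distr (lborel \<Otimes>\<^sub>M lborel) borel (join2 j)"
proof (rule lborel_eqI)
  fix l u :: "real^2"
  assume lu: "\<And>b. b \<in> Basis \<Longrightarrow> l \<bullet> b \<le> u \<bullet> b"
  have le: "l $ i \<le> u $ i" for i
    using lu[of "axis i 1"] by (simp add: inner_axis axis_in_Basis_iff)
  have "join2 j -` box l u = {l $ j <..< u $ j} \<times> {l $ (j + 1) <..< u $ (j + 1)}"
    by (auto simp: mem_box_cart all_2_split[of _ j])
  then have "emeasure (distr (lborel \<Otimes>\<^sub>M lborel) borel (join2 j)) (box l u)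
      = emeasure (lborel \<Otimes>\<^sub>M lborel) ({l $ j <..< u $ j} \<times> {l $ (j + 1) <..< u $ (j + 1)})"
    by (subst emeasure_distr) (auto simp: space_pair_measure)
  also have "\<dots> = ennreal ((u - l) $ j * (u - l) $ (j + 1))"
    by (subst lborel.emeasure_pair_measure_Times) (auto simp: le ennreal_mult)
  also have "(u - l) $ j * (u - l) $ (j + 1) = (\<Prod>i\<in>UNIV. (u - l) $ i)"
    by (simp add: prod_UNIV_2[of _ j])
  also have "\<dots> = (\<Prod>b\<in>Basis. (u - l) \<bullet> b)"
    unfolding Basis_vec_def
    by (simp add: UNION_singleton_eq_range)
       (subst prod.reindex, auto simp: inj_on_def axis_eq_axis inner_axis)
  finally show "emeasure (distr (lborel \<Otimes>\<^sub>M lborel) borel (join2 j)) (box l u) = (\<Prod>b\<in>Basis. (u - l) \<bullet> b)" .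
qed simp

text \<open>Fubini is applied to a product of two copies of \<open>lborel\<close>, so the completed
  measure is left here; continuity provides the Borel measurability that this requires.\<close>

lemma integral_Omega_eq_lborel:
  fixes f :: "real^2 \<Rightarrow> 'b :: euclidean_space"
  assumes "continuous_on UNIV f"
  shows "integral\<^sup>L (lebesgue_on (Omega L)) f = integral\<^sup>L lborel (\<lambda>x. indicator (Omega L) x *\<^sub>R f x)"
proof -
  have [measurable]: "f \<in> borel_measurable borel"
    using assms by (rule borel_measurable_continuous_onI)
  have [measurable]: "Omega L \<in> sets borel" by (simp add: Omega_eq_cbox)
  show ?thesis
    by (subst integral_restrict_space) (auto intro!: integral_completion)
qed

text \<open>Integration by parts on the torus in its barest form: Fubini puts direction
  \<open>j\<close> innermost, the fundamental theorem of calculus leaves the difference of two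
  endpoint values, and these agree by periodicity.\<close>

lemma integral_Omega_pderiv_zero:
  fixes f :: "real^2 \<Rightarrow> complex"
  assumes L: "L > 0" and per: "periodic L f" and diff: "\<And>x. f differentiable (at x)"
    and cont: "continuous_on UNIV (pderiv_at j f)"
  shows "integral\<^sup>L (lebesgue_on (Omega L)) (pderiv_at j f) = 0"
proof -
  let ?h = "\<lambda>x. indicator (Omega L) x *\<^sub>R pderiv_at j f x"
  have [measurable]: "pderiv_at j f \<in> borel_measurable borel"
    using cont by (rule borel_measurable_continuous_onI)
  have [measurable]: "Omega L \<in> sets borel" by (simp add: Omega_eq_cbox)
  have h[measurable]: "?h \<in> borel_measurable borel" by measurable
  have "compact (Omega L)" by (simp add: Omega_eq_cbox)
  then have "integrable lborel ?h"
    using cont continuous_on_subset by (intro borel_integrable_compact) auto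
  then have int: "integrable (lborel \<Otimes>\<^sub>M lborel) (\<lambda>(s, t). ?h (join2 j (s, t)))"
    by (subst (asm) lborel_join2[of j], subst (asm) integrable_distr_eq) (auto simp: case_prod_unfold)
  have inner: "integral\<^sup>L lborel (\<lambda>s. ?h (join2 j (s, t))) = 0" for t
  proof (cases "t \<in> {0..L}")
    case False
    then have "?h (join2 j (s, t)) = 0" for s
      by (auto simp: Omega_def all_2_split[of _ j])
    then show ?thesis by (simp only: Bochner_Integration.integral_zero)
  next
    case True
    have "join2 j (s, t) \<in> Omega L \<longleftrightarrow> s \<in> {0..L}" for s
      using True by (auto simp: Omega_def all_2_split[of _ j])
    then have "integral\<^sup>L lborel (\<lambda>s. ?h (join2 j (s, t)))
        = integral\<^sup>L lborel (\<lambda>s. indicator {0..L} s *\<^sub>R pderiv_at j f (join2 j (s, t)))"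
      by (intro Bochner_Integration.integral_cong) (auto simp: indicator_def)
    also have "\<dots> = f (join2 j (L, t)) - f (join2 j (0, t))"
    proof (rule integral_FTC_Icc)
      fix s
      have d: "(f has_derivative frechet_derivative f (at (join2 j (s, t)))) (at (join2 j (s, t)))"
        using diff frechet_derivative_works by blast
      have "((\<lambda>s. join2 j (s, t)) has_derivative (\<lambda>h. h *\<^sub>R axis j 1)) (at s within {0..L})"
        unfolding join2_def by (auto intro!: derivative_eq_intros)
      from has_derivative_compose[OF this d]
      have "((\<lambda>s. f (join2 j (s, t))) has_derivative
          (\<lambda>h. frechet_derivative f (at (join2 j (s, t))) (h *\<^sub>R axis j 1))) (at s within {0..L})" .
      then show "((\<lambda>s. f (join2 j (s, t))) has_vector_derivative pderiv_at j f (join2 j (s, t))) (at s within {0..L})"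
        unfolding has_vector_derivative_def pderiv_at_def
        using d[THEN has_derivative_bounded_linear] by (simp add: linear_simps)
    next
      show "continuous_on {0..L} (\<lambda>s. pderiv_at j f (join2 j (s, t)))"
        by (rule continuous_on_compose2[OF cont]) (auto simp: join2_def intro!: continuous_intros)
    qed (use L in simp)
    also have "join2 j (L, t) = join2 j (0, t) + L *\<^sub>R axis j 1"
      by (simp add: join2_def)
    finally show ?thesis using per by (simp add: periodic_def)
  qed
  have "integral\<^sup>L (lebesgue_on (Omega L)) (pderiv_at j f) = integral\<^sup>L lborel ?h"
    by (rule integral_Omega_eq_lborel[OF cont])
  also have "\<dots> = integral\<^sup>L (lborel \<Otimes>\<^sub>M lborel) (\<lambda>p. ?h (join2 j p))"
    by (subst lborel_join2[of j], subst integral_distr) auto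
  also have "\<dots> = integral\<^sup>L lborel (\<lambda>t. integral\<^sup>L lborel (\<lambda>s. ?h (join2 j (s, t))))"
    using lborel_pair.integral_snd[OF int] by (simp add: case_prod_unfold)
  also have "\<dots> = 0" by (simp add: inner)
  finally show ?thesis .
qed

section \<open>Smooth functions and single Fourier modes\<close>

lemma wave_nth [simp]: "wave k $ j = of_int (k $ j)"
  by (simp add: wave_def)

lemma wave_0 [simp]: "wave 0 = 0"
  by (simp add: vec_eq_iff)

lemma wave_uminus [simp]: "wave (- k) = - wave k"
  by (simp add: vec_eq_iff)

lemma wave_diff: "wave (k - l) = wave k - wave l"
  by (simp add: vec_eq_iff)

lemma wave_add: "wave (k + l) = wave k + wave l"
  by (simp add: vec_eq_iff)

lemma wave_inner_axis [simp]: "wave k \<bullet> axis j 1 = of_int (k $ j)"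
  by (simp add: inner_axis)

lemma pderiv_atI: "(f has_derivative f') (at x) \<Longrightarrow> pderiv_at j f x = f' (axis j 1)"
  using frechet_derivative_at[of f f' x] by (simp add: pderiv_at_def)

lemma differentiable_has_derivative:
  "f differentiable (at x) \<Longrightarrow> (f has_derivative frechet_derivative f (at x)) (at x)"
  using frechet_derivative_works by blast

lemma pderiv_at_add:
  assumes "f differentiable (at x)" "g differentiable (at x)"
  shows "pderiv_at j (\<lambda>x. f x + g x) x = pderiv_at j f x + pderiv_at j g x"
  using pderiv_atI[OF has_derivative_add[OF assms[THEN differentiable_has_derivative]]]
  by (simp add: pderiv_at_def)

lemma pderiv_at_scaleR:
  assumes "f differentiable (at x)"
  shows "pderiv_at j (\<lambda>x. c *\<^sub>R f x) x = c *\<^sub>R pderiv_at j f x"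
  using pderiv_atI[OF has_derivative_scaleR_right[OF assms[THEN differentiable_has_derivative]]]
  by (simp add: pderiv_at_def)

lemma pderiv_at_const [simp]: "pderiv_at j (\<lambda>x. c) = (\<lambda>x. 0)"
  using pderiv_atI[OF has_derivative_const] by (intro ext)

lemma C_k_add: "C_k n f \<Longrightarrow> C_k n g \<Longrightarrow> C_k n (\<lambda>x. f x + g x)"
proof (induction n arbitrary: f g)
  case 0
  then show ?case by (auto intro: continuous_intros)
next
  case (Suc n)
  then have "pderiv_at j (\<lambda>x. f x + g x) = (\<lambda>x. pderiv_at j f x + pderiv_at j g x)" for j
    by (intro ext pderiv_at_add) auto
  with Suc show ?case by auto
qed

lemma C_k_scaleR: "C_k n f \<Longrightarrow> C_k n (\<lambda>x. c *\<^sub>R f x)"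
proof (induction n arbitrary: f)
  case 0
  then show ?case by (auto intro: continuous_intros)
next
  case (Suc n)
  then have "pderiv_at j (\<lambda>x. c *\<^sub>R f x) = (\<lambda>x. c *\<^sub>R pderiv_at j f x)" for j
    by (intro ext pderiv_at_scaleR) auto
  with Suc show ?case by (auto intro!: differentiable_scaleR)
qed

lemma C_k_zero: "C_k n (\<lambda>x. 0)"
  by (induction n) auto

lemma smooth_add: "smooth f \<Longrightarrow> smooth g \<Longrightarrow> smooth (\<lambda>x. f x + g x)"
  by (simp add: smooth_def C_k_add)

lemma smooth_scaleR: "smooth f \<Longrightarrow> smooth (\<lambda>x. c *\<^sub>R f x)"
  by (simp add: smooth_def C_k_scaleR)

lemma smooth_zero: "smooth (\<lambda>x. 0)"
  by (simp add: smooth_def C_k_zero)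

lemma smooth_differentiable: "smooth f \<Longrightarrow> f differentiable (at x)"
  unfolding smooth_def using C_k.simps(2) by blast

lemma smooth_pderiv_at: "smooth f \<Longrightarrow> smooth (pderiv_at j f)"
  unfolding smooth_def using C_k.simps(2) by blast

lemma smooth_continuous: "smooth f \<Longrightarrow> continuous_on UNIV f"
  unfolding smooth_def using C_k.simps(1) by blast

lemma periodic_pderiv_at:
  assumes "smooth f" "periodic L f"
  shows "periodic L (pderiv_at j f)"
  unfolding periodic_def
proof (intro allI)
  fix x :: "real^2" and i :: 2
  let ?a = "L *\<^sub>R axis i 1 :: real^2"
  have "((\<lambda>y. f (y + ?a)) has_derivative (\<lambda>h. frechet_derivative f (at (x + ?a)) h)) (at x)"
  proof (rule has_derivative_compose[where f = "\<lambda>y. y + ?a" and f' = "\<lambda>h. h"])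
    show "((\<lambda>y. y + ?a) has_derivative (\<lambda>h. h)) (at x)"
      by (auto intro!: derivative_eq_intros)
    show "(f has_derivative frechet_derivative f (at (x + ?a))) (at (x + ?a))"
      using assms(1) by (intro differentiable_has_derivative smooth_differentiable)
  qed
  moreover have "(\<lambda>y. f (y + ?a)) = f"
    using assms(2) by (auto simp: periodic_def)
  ultimately show "pderiv_at j f (x + ?a) = pderiv_at j f x"
    using pderiv_atI[of f "frechet_derivative f (at (x + ?a))" x j] by (simp add: pderiv_at_def)
qed

lemma periodic_add: "periodic L f \<Longrightarrow> periodic L g \<Longrightarrow> periodic L (\<lambda>x. f x + g x)"
  by (simp add: periodic_def)

lemma has_derivative_cis_wave:
  "((\<lambda>x. cis (c * (w \<bullet> x))) has_derivative (\<lambda>h. (c * (w \<bullet> h)) *\<^sub>R (\<i> * cis (c * (w \<bullet> x))))) (at x)"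
  by (intro has_derivative_cis has_derivative_mult_right has_derivative_inner_right has_derivative_ident)

lemma pderiv_at_cis_wave:
  "pderiv_at j (\<lambda>x. cis (c * (w \<bullet> x))) = (\<lambda>x. \<i> * of_real (c * w $ j) * cis (c * (w \<bullet> x)))"
  using pderiv_atI[OF has_derivative_cis_wave]
  by (intro ext) (simp add: inner_axis scaleR_conv_of_real)

lemma cis_int_2pi: "cis (x + 2 * pi * of_int n) = cis x"
  by (simp add: cis_mult[symmetric] cis_multiple_2pi)

lemma periodic_cis_wave:
  assumes "L > 0"
  shows "periodic L (\<lambda>x. cis (kappa0 L * (wave k \<bullet> x)))"
proof -
  have "kappa0 L * (wave k \<bullet> (x + L *\<^sub>R axis j 1)) = kappa0 L * (wave k \<bullet> x) + 2 * pi * of_int (k $ j)"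
    for x j using assms by (simp add: kappa0_def inner_add_right algebra_simps)
  then show ?thesis by (simp only: periodic_def cis_int_2pi) simp
qed

lemma kappa0_pos [simp]: "L > 0 \<Longrightarrow> kappa0 L > 0"
  by (simp add: kappa0_def)

text \<open>If \<open>k $ j \<noteq> 0\<close>, the exponential is a nonzero multiple of its own
  derivative in direction \<open>j\<close>, and derivatives of periodic functions integrate to
  zero.\<close>

lemma integral_cis_wave:
  assumes "L > 0"
  shows "integral\<^sup>L (lebesgue_on (Omega L)) (\<lambda>x. cis (kappa0 L * (wave k \<bullet> x))) = (if k = 0 then of_real (L\<^sup>2) else 0)"
proof (cases "k = 0")
  case True
  then show ?thesis using integral_const_Omega[OF assms, of "1::complex"]
    by (simp add: scaleR_conv_of_real)
next
  case False
  then obtain j where j: "k $ j \<noteq> 0" by (auto simp: vec_eq_iff)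
  let ?f = "\<lambda>x. cis (kappa0 L * (wave k \<bullet> x))"
  have "integral\<^sup>L (lebesgue_on (Omega L)) (pderiv_at j ?f) = 0"
  proof (rule integral_Omega_pderiv_zero[OF assms periodic_cis_wave[OF assms]])
    show "?f differentiable at x" for x
      using has_derivative_cis_wave by (auto simp: differentiable_def)
    show "continuous_on UNIV (pderiv_at j ?f)"
      unfolding pderiv_at_cis_wave by (intro continuous_intros)
  qed
  then show ?thesis
    using j False kappa0_pos[OF assms] by (simp add: pderiv_at_cis_wave)
qed

text \<open>Taking the real part keeps finite sums real-valued without pairing \<open>k\<close> with
  \<open>- k\<close>. The price is that a mode occupies both frequencies, with half the amplitude at
  each.\<close>

definition mode :: "real \<Rightarrow> int^2 \<Rightarrow> complex^2 \<Rightarrow> real^2 \<Rightarrow> real^2" where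
  "mode L k a x = (\<chi> j. Re (a $ j * cis (kappa0 L * (wave k \<bullet> x))))"

lemma mode_nth: "mode L k a x $ j = Re (a $ j * cis (kappa0 L * (wave k \<bullet> x)))"
  by (simp add: mode_def)

lemma norm_mode_le: "norm (mode L k a x) \<le> norm a"
  unfolding norm_vec_def
proof (rule L2_set_mono)
  fix j
  have "\<bar>Re (a $ j * cis (kappa0 L * (wave k \<bullet> x)))\<bar> \<le> norm (a $ j * cis (kappa0 L * (wave k \<bullet> x)))"
    by (rule abs_Re_le_cmod)
  then show "norm (mode L k a x $ j) \<le> norm (a $ j)"
    by (simp add: mode_nth norm_mult)
qed simp

lemma mode_scaleR: "r *\<^sub>R mode L k a x = mode L k (of_real r *s a) x"
  by (simp add: vec_eq_iff mode_nth mult.assoc)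

lemma mode_has_derivative:
  "(mode L k a has_derivative (\<lambda>h. (kappa0 L * (wave k \<bullet> h)) *\<^sub>R mode L k (\<i> *s a) x)) (at x)"
proof -
  let ?T = "\<lambda>z. (\<chi> j. Re (a $ j * z)) :: real^2"
  have T: "bounded_linear ?T"
    unfolding linear_conv_bounded_linear[symmetric]
    by (intro linearI) (auto simp: vec_eq_iff algebra_simps)
  have eq: "mode L k a = (\<lambda>x. ?T (cis (kappa0 L * (wave k \<bullet> x))))"
    by (simp add: fun_eq_iff mode_def)
  show ?thesis
    unfolding eq
    by (rule has_derivative_eq_rhs[OF bounded_linear.has_derivative[OF T has_derivative_cis_wave]])
       (auto simp: fun_eq_iff vec_eq_iff mode_nth algebra_simps)
qed

lemma pderiv_at_mode:
  "pderiv_at j (mode L k a) = mode L k ((\<i> * of_real (kappa0 L * of_int (k $ j))) *s a)"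
  using pderiv_atI[OF mode_has_derivative]
  by (intro ext) (simp add: mode_scaleR vec_eq_iff mode_nth algebra_simps)

text \<open>Every partial derivative of a mode is a mode with another amplitude, so the induction
  must leave the amplitude free.\<close>

lemma smooth_mode: "smooth (mode L k a)"
proof -
  have "C_k n (mode L k a)" for n
  proof (induction n arbitrary: a)
    case 0
    have "mode L k a differentiable (at x)" for x
      by (rule differentiableI[OF mode_has_derivative])
    then show ?case
      by (simp add: differentiable_imp_continuous_within continuous_on_eq_continuous_within)
  next
    case (Suc n)
    have "mode L k a differentiable (at x)" for x
      by (rule differentiableI[OF mode_has_derivative])
    with Suc show ?case by (simp add: pderiv_at_mode)
  qed
  then show ?thesis by (simp add: smooth_def)
qed

lemma periodic_mode: "L > 0 \<Longrightarrow> periodic L (mode L k a)"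
  using periodic_cis_wave[of L k] by (simp add: periodic_def mode_def vec_eq_iff)

lemma mode_L2: "mode L k a \<in> L2_space L"
  by (intro L2_space_continuous smooth_continuous smooth_mode)

text \<open>The real part is half the sum of two conjugate exponentials, to which orthogonality
  applies. For \<open>l = k = 0\<close> both conditions hold and the two terms combine to the real
  part of \<open>a $ j\<close>.\<close>

lemma fourier_mode:
  assumes "L > 0"
  shows "fourier L (mode L l a) k $ j = ((if l = k then a $ j else 0) + (if l = - k then cnj (a $ j) else 0)) / 2"
proof -
  let ?e = "\<lambda>m x. cis (kappa0 L * (wave m \<bullet> x))"
  have int: "integrable (lebesgue_on (Omega L)) (?e m)" for m
    by (intro integrable_Omega_continuous continuous_on_cis_wave)
  have "of_real (mode L l a x $ j) * cis (- (kappa0 L * (wave k \<bullet> x)))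
      = (a $ j / 2) * ?e (l - k) x + (cnj (a $ j) / 2) * ?e (- (l + k)) x" for x
  proof -
    have *: "of_real (mode L l a x $ j) = (a $ j * ?e l x + cnj (a $ j) * ?e (- l) x) / 2"
      by (simp add: mode_nth complex_eq_iff field_simps)
    show ?thesis
      unfolding * by (simp add: wave_diff wave_add inner_add_left inner_diff_left algebra_simps
          cis_mult add_divide_distrib)
  qed
  then have "integral\<^sup>L (lebesgue_on (Omega L)) (\<lambda>x. of_real (mode L l a x $ j) * cis (- (kappa0 L * (wave k \<bullet> x))))
     = (a $ j / 2) * integral\<^sup>L (lebesgue_on (Omega L)) (?e (l - k))
       + (cnj (a $ j) / 2) * integral\<^sup>L (lebesgue_on (Omega L)) (?e (- (l + k)))"
    using int[of "l - k"] int[of "- (l + k)"] by simp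
  also have "\<dots> = ((if l = k then a $ j else 0) + (if l = - k then cnj (a $ j) else 0)) / 2 * of_real (L\<^sup>2)"
  proof -
    have "l - k = 0 \<longleftrightarrow> l = k" "- (l + k) = 0 \<longleftrightarrow> l = - k"
      by (simp_all only: eq_iff_diff_eq_0[symmetric] neg_equal_0_iff_equal add_eq_0_iff2)
    moreover have "x / 2 * (if P then z else 0) + y / 2 * (if Q then z else 0)
        = ((if P then x else 0) + (if Q then y else 0)) / 2 * z" for P Q and x y z :: complex
      by (simp add: field_simps)
    ultimately show ?thesis unfolding integral_cis_wave[OF assms] by (simp only:)
  qed
  finally show ?thesis using assms by (simp add: fourier_eq_cis)
qed

text \<open>The product of a component of \<open>u\<close> with the conjugate exponential is
  periodic, so its derivative integrates to zero; the product rule splits that integral into the two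
  sides of the claim.\<close>

lemma fourier_pderiv_at:
  fixes u :: "real^2 \<Rightarrow> real^2"
  assumes L: "L > 0" and u: "smooth u" "periodic L u"
  shows "fourier L (pderiv_at j u) k = (\<i> * of_real (kappa0 L * of_int (k $ j))) *s fourier L u k"
proof -
  have "fourier L (pderiv_at j u) k $ i = \<i> * of_real (kappa0 L * of_int (k $ j)) * fourier L u k $ i" for i
  proof -
    let ?e = "\<lambda>x. cis (- kappa0 L * (wave k \<bullet> x))"
    let ?f = "\<lambda>x. of_real (u x $ i) * ?e x"
    let ?c = "\<i> * of_real (kappa0 L * of_int (k $ j))"
    have du: "(u has_derivative frechet_derivative u (at x)) (at x)" for x
      using u by (intro differentiable_has_derivative smooth_differentiable)
    have d: "(?f has_derivative (\<lambda>h. of_real (u x $ i) * ((- kappa0 L * (wave k \<bullet> h)) *\<^sub>R (\<i> * ?e x))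
        + of_real (frechet_derivative u (at x) h $ i) * ?e x)) (at x)" for x
      by (intro has_derivative_mult has_derivative_of_real has_derivative_cis_wave
          bounded_linear.has_derivative[OF bounded_linear_vec_nth du])
    have pd: "pderiv_at j ?f = (\<lambda>x. of_real (pderiv_at j u x $ i) * ?e x - ?c * (of_real (u x $ i) * ?e x))"
      using pderiv_atI[OF d] by (intro ext) (simp add: pderiv_at_def scaleR_conv_of_real)
    have i1: "integrable (lebesgue_on (Omega L)) (\<lambda>x. of_real (pderiv_at j u x $ i) * ?e x)"
      "integrable (lebesgue_on (Omega L)) (\<lambda>x. of_real (u x $ i) * ?e x)"
      by (rule integrable_component_cis,
          intro L2_space_continuous smooth_continuous smooth_pderiv_at u)+
    have "integral\<^sup>L (lebesgue_on (Omega L)) (pderiv_at j ?f) = 0"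
    proof (rule integral_Omega_pderiv_zero[OF L])
      show "periodic L ?f"
        using u periodic_cis_wave[OF L, of "- k"] by (simp add: periodic_def)
      show "?f differentiable at x" for x
        using d[of x] by (auto simp: differentiable_def)
      show "continuous_on UNIV (pderiv_at j ?f)"
        unfolding pd using u
        by (intro continuous_intros smooth_continuous smooth_pderiv_at)
    qed
    then show ?thesis
      unfolding pd using i1 by (simp add: fourier_eq_cis)
  qed
  then show ?thesis by (simp add: vec_eq_iff)
qed

section \<open>Trigonometric polynomials and the space \<open>H\<close>\<close>

lemma H_space_L2: "u \<in> H_space L \<Longrightarrow> u \<in> L2_space L"
  by (simp add: H_space_def)

lemma trig_poly_eq_sum_mode:
  assumes "trig_poly L v"
  obtains K c where "finite K" "v = (\<lambda>x. \<Sum>k\<in>K. mode L k (c k) x)"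
proof -
  obtain K c where K: "finite K" and
    *: "\<And>x j. complex_of_real (v x $ j) = (\<Sum>k\<in>K. c k $ j * cis (kappa0 L * (wave k \<bullet> x)))"
    using assms unfolding trig_poly_def cis_conv_exp by blast
  have "v x $ j = (\<Sum>k\<in>K. mode L k (c k) x) $ j" for x j
    using arg_cong[OF *[of x j], of Re] by (simp add: mode_nth)
  then show ?thesis using K that[of K c] by (simp add: vec_eq_iff fun_eq_iff)
qed

lemma
  assumes "L > 0" "finite K"
  shows smooth_sum_mode: "smooth (\<lambda>x. \<Sum>k\<in>K. mode L (f k) (c k) x)"
    and periodic_sum_mode: "periodic L (\<lambda>x. \<Sum>k\<in>K. mode L (f k) (c k) x)"
proof -
  show "smooth (\<lambda>x. \<Sum>k\<in>K. mode L (f k) (c k) x)"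
    using assms(2) by (induction K rule: finite_induct) (auto intro: smooth_zero smooth_add smooth_mode)
  show "periodic L (\<lambda>x. \<Sum>k\<in>K. mode L (f k) (c k) x)"
    using periodic_mode[OF assms(1)] by (simp add: periodic_def)
qed

lemma
  assumes "L > 0" "trig_poly L v"
  shows smooth_trig_poly: "smooth v" and periodic_trig_poly: "periodic L v"
proof -
  obtain K c where "finite K" "v = (\<lambda>x. \<Sum>k\<in>K. mode L k (c k) x)"
    using trig_poly_eq_sum_mode[OF assms(2)] .
  then show "smooth v" "periodic L v"
    using smooth_sum_mode[OF assms(1), where f = "\<lambda>k. k"] periodic_sum_mode[OF assms(1), where f = "\<lambda>k. k"]
    by auto
qed

lemma trig_poly_L2: "L > 0 \<Longrightarrow> trig_poly L v \<Longrightarrow> v \<in> L2_space L"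
  by (intro L2_space_continuous smooth_continuous smooth_trig_poly)

lemma trig_polyI:
  assumes "finite K" 
    and "\<And>x j. complex_of_real (v x $ j) = (\<Sum>k\<in>K. c k $ j * cis (kappa0 L * (wave k \<bullet> x)))"
  shows "trig_poly L v"
  using assms unfolding trig_poly_def cis_conv_exp by blast

lemma trig_poly_mode: "trig_poly L (mode L k a)"
proof (rule trig_polyI)
  \<comment> \<open>Adding two conditionals also covers \<open>k = 0\<close>, where \<open>k\<close>
    and \<open>- k\<close> coincide and both halves fall on the same frequency.\<close>
  let ?c = "\<lambda>l. (if l = k then \<chi> j. a $ j / 2 else 0) + (if l = - k then \<chi> j. cnj (a $ j) / 2 else 0)"
  show "finite {k, - k}" by simp
  fix x j
  let ?e = "\<lambda>m. cis (kappa0 L * (wave m \<bullet> x))"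
  have "(\<Sum>l\<in>{k, - k}. ?c l $ j * ?e l)
      = (\<Sum>l\<in>{k, - k}. (if l = k then a $ j / 2 * ?e k else 0) + (if l = - k then cnj (a $ j) / 2 * ?e (- k) else 0))"
  proof (rule sum.cong[OF refl])
    fix l
    have "(if l = k then \<chi> j. a $ j / 2 else 0) $ j * ?e l = (if l = k then a $ j / 2 * ?e k else 0)"
      by (cases "l = k") simp_all
    moreover have "(if l = - k then \<chi> j. cnj (a $ j) / 2 else 0) $ j * ?e l
        = (if l = - k then cnj (a $ j) / 2 * ?e (- k) else 0)"
      by (cases "l = - k") simp_all
    ultimately show "?c l $ j * ?e l
        = (if l = k then a $ j / 2 * ?e k else 0) + (if l = - k then cnj (a $ j) / 2 * ?e (- k) else 0)"
      by (simp only: vector_add_component distrib_right)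
  qed
  also have "\<dots> = a $ j / 2 * ?e k + cnj (a $ j) / 2 * ?e (- k)"
    unfolding sum.distrib by (simp add: sum.delta)
  also have "\<dots> = of_real (mode L k a x $ j)"
    by (simp add: mode_nth complex_eq_iff field_simps)
  finally show "complex_of_real (mode L k a x $ j) = (\<Sum>l\<in>{k, - k}. ?c l $ j * ?e l)" by simp
qed

lemma trig_poly_zero: "trig_poly L (\<lambda>x. 0)"
  by (rule trig_polyI[of "{}"]) auto

lemma trig_poly_add:
  assumes "trig_poly L u" "trig_poly L v"
  shows "trig_poly L (\<lambda>x. u x + v x)"
proof -
  obtain K c where K: "finite K" and
    u: "\<And>x j. complex_of_real (u x $ j) = (\<Sum>k\<in>K. c k $ j * cis (kappa0 L * (wave k \<bullet> x)))"
    using assms(1) unfolding trig_poly_def cis_conv_exp by blast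
  obtain K' c' where K': "finite K'" and
    v: "\<And>x j. complex_of_real (v x $ j) = (\<Sum>k\<in>K'. c' k $ j * cis (kappa0 L * (wave k \<bullet> x)))"
    using assms(2) unfolding trig_poly_def cis_conv_exp by blast
  show ?thesis
  proof (rule trig_polyI)
    show "finite (K \<union> K')" using K K' by simp
    fix x j
    let ?e = "\<lambda>m. cis (kappa0 L * (wave m \<bullet> x))"
    let ?c = "\<lambda>k. (if k \<in> K then c k else 0) + (if k \<in> K' then c' k else 0)"
    have "(\<Sum>k\<in>K \<union> K'. ?c k $ j * ?e k)
       = (\<Sum>k\<in>K \<union> K'. if k \<in> K then c k $ j * ?e k else 0) + (\<Sum>k\<in>K \<union> K'. if k \<in> K' then c' k $ j * ?e k else 0)"
      unfolding sum.distrib[symmetric] by (intro sum.cong) (auto simp: algebra_simps)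
    also have "\<dots> = of_real (u x $ j) + of_real (v x $ j)"
      unfolding u v using K K' by (intro arg_cong2[of _ _ _ _ "(+)"] sum.mono_neutral_cong_right) auto
    finally show "complex_of_real ((u x + v x) $ j) = (\<Sum>k\<in>K \<union> K'. ?c k $ j * ?e k)" by simp
  qed
qed

lemma trig_poly_scaleR:
  assumes "trig_poly L u"
  shows "trig_poly L (\<lambda>x. r *\<^sub>R u x)"
proof -
  obtain K c where K: "finite K" and
    u: "\<And>x j. complex_of_real (u x $ j) = (\<Sum>k\<in>K. c k $ j * cis (kappa0 L * (wave k \<bullet> x)))"
    using assms(1) unfolding trig_poly_def cis_conv_exp by blast
  show ?thesis
    by (rule trig_polyI[OF K, where c = "\<lambda>k. of_real r *s c k"])
       (simp add: u sum_distrib_left mult.assoc)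
qed

lemma divergence_add:
  assumes "smooth u" "smooth v"
  shows "divergence (\<lambda>x. u x + v x) x = divergence u x + divergence v x"
  using assms by (simp add: divergence_def pderiv_at_add smooth_differentiable sum.distrib)

lemma divergence_scaleR:
  assumes "smooth u"
  shows "divergence (\<lambda>x. r *\<^sub>R u x) x = r * divergence u x"
  using assms by (simp add: divergence_def pderiv_at_scaleR smooth_differentiable sum_distrib_left)

lemma divergence_mode:
  assumes "(\<Sum>j\<in>UNIV. of_int (k $ j) * a $ j) = 0"
  shows "divergence (mode L k a) x = 0"
proof -
  have "divergence (mode L k a) x
      = Re (\<Sum>j\<in>UNIV. \<i> * of_real (kappa0 L) * cis (kappa0 L * (wave k \<bullet> x)) * (of_int (k $ j) * a $ j))"
    by (simp add: divergence_def pderiv_at_mode mode_nth algebra_simps)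
  also have "\<dots> = 0" unfolding sum_distrib_left[symmetric] assms by simp
  finally show ?thesis .
qed

lemma integral_eq_0_iff_fourier_0:
  assumes "L > 0" "continuous_on UNIV v"
  shows "integral\<^sup>L (lebesgue_on (Omega L)) v = 0 \<longleftrightarrow> fourier L v 0 = 0"
proof -
  let ?I = "integral\<^sup>L (lebesgue_on (Omega L))"
  have "fourier L v 0 $ j = of_real (?I v $ j) / of_real (L\<^sup>2)" for j
  proof -
    have "?I (\<lambda>x. complex_of_real (v x $ j)) = of_real (?I (\<lambda>x. v x $ j))"
      by (rule integral_complex_of_real)
    moreover have "?I (\<lambda>x. v x $ j) = ?I v $ j"
      by (rule integral_bounded_linear[OF bounded_linear_vec_nth integrable_Omega_continuous[OF assms(2)]])
    ultimately show ?thesis by (simp add: fourier_eq_cis)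
  qed
  then show ?thesis using assms(1) by (simp add: vec_eq_iff)
qed

section \<open>Solenoidal polynomials and \<open>H_space\<close> as linear spaces\<close>

lemma solenoidal_polys_add:
  assumes "L > 0" "u \<in> solenoidal_polys L" "v \<in> solenoidal_polys L"
  shows "(\<lambda>x. u x + v x) \<in> solenoidal_polys L"
proof -
  have t: "trig_poly L u" "trig_poly L v" using assms by (auto simp: solenoidal_polys_def)
  then have s: "smooth u" "smooth v" using assms(1) by (auto intro: smooth_trig_poly)
  then show ?thesis using assms t
    by (simp add: solenoidal_polys_def trig_poly_add divergence_add integrable_Omega_continuous smooth_continuous)
qed

lemma solenoidal_polys_scaleR:
  assumes "L > 0" "u \<in> solenoidal_polys L"
  shows "(\<lambda>x. r *\<^sub>R u x) \<in> solenoidal_polys L"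
proof -
  have t: "trig_poly L u" using assms by (auto simp: solenoidal_polys_def)
  then have s: "smooth u" using assms(1) by (auto intro: smooth_trig_poly)
  then show ?thesis using assms t
    by (simp add: solenoidal_polys_def trig_poly_scaleR divergence_scaleR)
qed

lemma solenoidal_polys_zero: "(\<lambda>x. 0) \<in> solenoidal_polys L"
  by (simp add: solenoidal_polys_def trig_poly_zero divergence_def)

lemma solenoidal_polys_mode:
  assumes "L > 0" "(\<Sum>j\<in>UNIV. of_int (k $ j) * a $ j) = 0" "k = 0 \<Longrightarrow> a = 0"
  shows "mode L k a \<in> solenoidal_polys L"
proof -
  have "fourier L (mode L k a) 0 = 0"
    using assms by (auto simp: vec_eq_iff fourier_mode)
  then show ?thesis
    using assms by (simp add: solenoidal_polys_def trig_poly_mode divergence_mode integral_eq_0_iff_fourier_0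
        smooth_mode smooth_continuous)
qed

lemma H_space_add:
  assumes "L > 0" "u \<in> H_space L" "v \<in> H_space L"
  shows "(\<lambda>x. u x + v x) \<in> H_space L"
  unfolding H_space_def
proof (intro CollectI conjI allI impI)
  show "(\<lambda>x. u x + v x) \<in> L2_space L" using assms by (intro L2_space_add H_space_L2)
  fix e :: real assume "e > 0"
  then have e: "e / 2 > 0" by simp
  obtain p where p: "p \<in> solenoidal_polys L" "L2_norm L (\<lambda>x. u x - p x) < e / 2"
    using assms(2) e unfolding H_space_def by blast
  obtain q where q: "q \<in> solenoidal_polys L" "L2_norm L (\<lambda>x. v x - q x) < e / 2"
    using assms(3) e unfolding H_space_def by blast
  have "p \<in> L2_space L" "q \<in> L2_space L"
    using p q assms(1) by (auto simp: solenoidal_polys_def intro: trig_poly_L2)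
  then have "L2_norm L (\<lambda>x. (u x - p x) + (v x - q x)) \<le> L2_norm L (\<lambda>x. u x - p x) + L2_norm L (\<lambda>x. v x - q x)"
    using assms(2,3)[THEN H_space_L2] by (intro L2_norm_triangle L2_space_diff)
  then have "L2_norm L (\<lambda>x. u x + v x - (p x + q x)) < e"
    using p q by (simp add: algebra_simps)
  then show "\<exists>w\<in>solenoidal_polys L. L2_norm L (\<lambda>x. u x + v x - w x) < e"
    by (rule bexI[OF _ solenoidal_polys_add[OF assms(1) p(1) q(1)]])
qed

lemma H_space_scaleR:
  assumes "L > 0" "u \<in> H_space L"
  shows "(\<lambda>x. r *\<^sub>R u x) \<in> H_space L"
  unfolding H_space_def
proof (intro CollectI conjI allI impI)
  show "(\<lambda>x. r *\<^sub>R u x) \<in> L2_space L" using assms by (intro L2_space_scaleR H_space_L2)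
  fix e :: real assume e: "e > 0"
  then have "e / (\<bar>r\<bar> + 1) > 0" by simp
  then obtain p where p: "p \<in> solenoidal_polys L" "L2_norm L (\<lambda>x. u x - p x) < e / (\<bar>r\<bar> + 1)"
    using assms unfolding H_space_def by blast
  have "L2_norm L (\<lambda>x. r *\<^sub>R u x - r *\<^sub>R p x) = \<bar>r\<bar> * L2_norm L (\<lambda>x. u x - p x)"
    unfolding scaleR_diff_right[symmetric] by (rule L2_norm_scaleR)
  also have "\<dots> \<le> (\<bar>r\<bar> + 1) * L2_norm L (\<lambda>x. u x - p x)" by (intro mult_right_mono) auto
  also have "\<dots> < e" using p(2) by (simp add: field_simps)
  finally show "\<exists>w\<in>solenoidal_polys L. L2_norm L (\<lambda>x. r *\<^sub>R u x - w x) < e"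
    by (rule bexI[OF _ solenoidal_polys_scaleR[OF assms(1) p(1), of r]])
qed

lemma H_space_diff:
  assumes "L > 0" "u \<in> H_space L" "v \<in> H_space L"
  shows "(\<lambda>x. u x - v x) \<in> H_space L"
  using H_space_add[OF assms(1,2) H_space_scaleR[OF assms(1,3), of "-1"]] by simp

lemma H_space_minus:
  assumes "L > 0" "u \<in> H_space L"
  shows "(\<lambda>x. - u x) \<in> H_space L"
  using H_space_scaleR[OF assms, of "-1"] by simp

text \<open>The constraints on the coefficients say that the mean vanishes, that the divergence vanishes,
  and that the field is real.\<close>

definition solenoidal_coeffs :: "(int^2 \<Rightarrow> complex^2) \<Rightarrow> bool" where
  "solenoidal_coeffs c \<longleftrightarrow> c 0 = 0 \<and> (\<forall>k. (\<Sum>j\<in>UNIV. of_int (k $ j) * c k $ j) = 0)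
     \<and> (\<forall>k j. c (- k) $ j = cnj (c k $ j))"

text \<open>The coefficient of the divergence at \<open>k\<close> is \<open>\<i> * kappa0 L\<close>
  times the sum in question, and the divergence vanishes identically.\<close>

lemma fourier_solenoidal_poly:
  assumes L: "L > 0" and v: "v \<in> solenoidal_polys L"
  shows "fourier L v 0 = 0" and "(\<Sum>j\<in>UNIV. of_int (k $ j) * fourier L v k $ j) = 0"
proof -
  have t: "smooth v" "periodic L v"
    using assms by (auto simp: solenoidal_polys_def intro: smooth_trig_poly periodic_trig_poly)
  then show "fourier L v 0 = 0"
    using v L integral_eq_0_iff_fourier_0 smooth_continuous by (auto simp: solenoidal_polys_def)
  let ?M = "lebesgue_on (Omega L)"
  have "\<i> * of_real (kappa0 L) * (\<Sum>j\<in>UNIV. of_int (k $ j) * fourier L v k $ j)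
     = (\<Sum>j\<in>UNIV. fourier L (pderiv_at j v) k $ j)"
    by (simp add: fourier_pderiv_at[OF L t] sum_distrib_left algebra_simps)
  also have "\<dots> = integral\<^sup>L ?M (\<lambda>x. \<Sum>j\<in>UNIV. of_real (pderiv_at j v x $ j) * cis (- (kappa0 L * (wave k \<bullet> x))))
      / of_real (L\<^sup>2)"
    using t by (subst Bochner_Integration.integral_sum)
      (auto simp: fourier_eq_cis sum_divide_distrib intro!: integrable_fourier L2_space_continuous smooth_continuous smooth_pderiv_at)
  also have "(\<lambda>x. \<Sum>j\<in>UNIV. of_real (pderiv_at j v x $ j) * cis (- (kappa0 L * (wave k \<bullet> x))))
     = (\<lambda>x. of_real (divergence v x) * cis (- (kappa0 L * (wave k \<bullet> x))))"
    by (simp add: divergence_def sum_distrib_right)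
  also have "\<dots> = (\<lambda>x. 0)" using v by (simp add: solenoidal_polys_def)
  finally show "(\<Sum>j\<in>UNIV. of_int (k $ j) * fourier L v k $ j) = 0"
    using kappa0_pos[OF L] by simp
qed

lemma norm_le_all_pos_imp_0:
  fixes z :: "'a :: real_normed_vector"
  assumes "\<And>e. e > 0 \<Longrightarrow> norm z \<le> C * e"
  shows "z = 0"
proof (rule ccontr)
  assume "z \<noteq> 0"
  \<comment> \<open>This choice of \<open>e\<close> brings the bound strictly below
    \<open>norm z\<close>; the \<open>+ 1\<close> keeps the denominator positive when
    \<open>C = 0\<close>.\<close>
  have "norm z \<le> C * (norm z / (2 * (\<bar>C\<bar> + 1)))" using \<open>z \<noteq> 0\<close> by (intro assms) simp
  also have "\<dots> \<le> \<bar>C\<bar> * (norm z / (2 * (\<bar>C\<bar> + 1)))" by (intro mult_right_mono) auto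
  also have "\<dots> = norm z * (\<bar>C\<bar> / (2 * (\<bar>C\<bar> + 1)))" by simp
  also have "\<dots> < norm z * 1" using \<open>z \<noteq> 0\<close> by (intro mult_strict_left_mono) (auto simp: field_simps)
  finally show False by simp
qed

text \<open>Zero mean and zero divergence are closed conditions on single coefficients, and each
  coefficient depends continuously on the field in \<open>L2_norm\<close>; they pass from the
  approximating polynomials to the limit. Conjugate symmetry expresses that fields are real.\<close>

lemma solenoidal_coeffs_fourier:
  assumes L: "L > 0" and u: "u \<in> H_space L"
  shows "solenoidal_coeffs (fourier L u)"
  unfolding solenoidal_coeffs_def
proof (intro conjI allI)
  have approx: "\<exists>v\<in>solenoidal_polys L. \<forall>k j. norm (fourier L u k $ j - fourier L v k $ j) \<le> e / L"
    if "e > 0" for e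
  proof -
    obtain v where v: "v \<in> solenoidal_polys L" "L2_norm L (\<lambda>x. u x - v x) < e"
      using u \<open>e > 0\<close> unfolding H_space_def by blast
    have vL: "v \<in> L2_space L" using v L by (auto simp: solenoidal_polys_def intro: trig_poly_L2)
    have "norm (fourier L u k $ j - fourier L v k $ j) \<le> e / L" for k j
    proof -
      have "norm (fourier L (\<lambda>x. u x - v x) k $ j) \<le> L2_norm L (\<lambda>x. u x - v x) / L"
        using L H_space_L2[OF u] vL by (intro norm_fourier_component_le L2_space_diff)
      also have "\<dots> \<le> e / L" using v L by (intro divide_right_mono) auto
      finally show ?thesis using u vL by (simp add: fourier_diff H_space_L2)
    qed
    with v show ?thesis by blast
  qed
  show "fourier L u 0 = 0"
    unfolding vec_eq_iff
  proof
    fix j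
    have "fourier L u 0 $ j = 0"
    proof (rule norm_le_all_pos_imp_0[where C = "1 / L"])
      fix e :: real assume "e > 0"
      then obtain v where "v \<in> solenoidal_polys L" "norm (fourier L u 0 $ j - fourier L v 0 $ j) \<le> e / L"
        using approx by blast
      then show "norm (fourier L u 0 $ j) \<le> 1 / L * e"
        using fourier_solenoidal_poly(1)[OF L, of v] by simp
    qed
    then show "fourier L u 0 $ j = 0 $ j" by simp
  qed
  fix k
  show "(\<Sum>j\<in>UNIV. of_int (k $ j) * fourier L u k $ j) = 0"
  proof (rule norm_le_all_pos_imp_0[where C = "(\<Sum>j\<in>UNIV. \<bar>of_int (k $ j)\<bar>) / L"])
    fix e :: real assume "e > 0"
    then obtain v where v: "v \<in> solenoidal_polys L"
      "\<And>j. norm (fourier L u k $ j - fourier L v k $ j) \<le> e / L"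
      using approx by blast
    \<comment> \<open>The corresponding sum for \<open>v\<close> is zero and may be
      subtracted.\<close>
    have "(\<Sum>j\<in>UNIV. of_int (k $ j) * fourier L u k $ j)
        = (\<Sum>j\<in>UNIV. of_int (k $ j) * (fourier L u k $ j - fourier L v k $ j))"
      using fourier_solenoidal_poly(2)[OF L v(1), of k] by (simp add: right_diff_distrib sum_subtractf)
    also have "norm \<dots> \<le> (\<Sum>j\<in>UNIV. \<bar>of_int (k $ j)\<bar> * (e / L))"
    proof (rule sum_norm_le)
      fix j
      show "norm (of_int (k $ j) * (fourier L u k $ j - fourier L v k $ j)) \<le> \<bar>of_int (k $ j)\<bar> * (e / L)"
        unfolding norm_mult norm_of_int of_int_abs by (intro mult_left_mono v) simp
    qed
    finally show "norm (\<Sum>j\<in>UNIV. of_int (k $ j) * fourier L u k $ j)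
        \<le> (\<Sum>j\<in>UNIV. \<bar>of_int (k $ j)\<bar>) / L * e"
      by (simp add: sum_distrib_right sum_divide_distrib)
  qed
qed (rule fourier_uminus_wave)

lemma L2_inner_trig_poly_eq_0:
  assumes L: "L > 0" and f: "f \<in> L2_space L" "\<And>k. fourier L f k = 0" and v: "trig_poly L v"
  shows "L2_inner L f v = 0"
proof -
  let ?M = "lebesgue_on (Omega L)"
  obtain K c where K: "finite K" and
    *: "\<And>x j. complex_of_real (v x $ j) = (\<Sum>k\<in>K. c k $ j * cis (kappa0 L * (wave k \<bullet> x)))"
    using v unfolding trig_poly_def cis_conv_exp by blast
  have int: "integrable ?M (\<lambda>x. of_real (f x $ j) * cis (kappa0 L * (wave k \<bullet> x)))" for k j
    using f(1) by (rule integrable_component_cis)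
  have zero: "integral\<^sup>L ?M (\<lambda>x. of_real (f x $ j) * cis (kappa0 L * (wave k \<bullet> x))) = 0" for k j
    using arg_cong[OF f(2)[of "- k"], of "\<lambda>a. a $ j"] L by (simp add: fourier_eq_cis)
  have "complex_of_real (L2_inner L f v) = integral\<^sup>L ?M (\<lambda>x. of_real (f x \<bullet> v x))"
    by (simp add: L2_inner_def)
  also have "(\<lambda>x. complex_of_real (f x \<bullet> v x))
     = (\<lambda>x. \<Sum>j\<in>UNIV. \<Sum>k\<in>K. c k $ j * (of_real (f x $ j) * cis (kappa0 L * (wave k \<bullet> x))))"
    by (simp add: inner_vec_def * sum_distrib_left algebra_simps)
  also have "integral\<^sup>L ?M \<dots> = 0"
    using int by (simp add: zero)
  finally show ?thesis by simp
qed

text \<open>Because \<open>H_space\<close> is by definition a closure of polynomials, completeness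
  of the trigonometric system is built in: \<open>f\<close> is orthogonal to each approximant
  \<open>v\<close>, so \<open>(f, f) = (f, f - v)\<close>, and Cauchy-Schwarz bounds the norm of
  \<open>f\<close> by that of \<open>f - v\<close>.\<close>

lemma H_space_fourier_unique:
  assumes L: "L > 0" and f: "f \<in> H_space L" "\<And>k. fourier L f k = 0"
  shows "L2_norm L f = 0"
proof (rule norm_le_all_pos_imp_0[where C = 1])
  fix e :: real assume "e > 0"
  then obtain v where v: "v \<in> solenoidal_polys L" "L2_norm L (\<lambda>x. f x - v x) < e"
    using f(1) unfolding H_space_def by blast
  have fv: "trig_poly L v" "v \<in> L2_space L" "f \<in> L2_space L"
    using v f L by (auto simp: solenoidal_polys_def intro: trig_poly_L2 H_space_L2)
  have "(L2_norm L f)\<^sup>2 = L2_inner L f (\<lambda>x. f x - v x)"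
    using fv L2_inner_trig_poly_eq_0[OF L fv(3) f(2) fv(1)]
    by (simp add: L2_inner_diff_left L2_norm_def) (simp add: L2_inner_def)
  also have "\<dots> \<le> L2_norm L f * L2_norm L (\<lambda>x. f x - v x)"
    using L2_Cauchy_Schwarz[OF fv(3) L2_space_diff[OF fv(3,2)]] by simp
  finally have "L2_norm L f \<le> L2_norm L (\<lambda>x. f x - v x)"
    by (cases "L2_norm L f = 0") (auto simp: power2_eq_square less_le)
  with v show "norm (L2_norm L f) \<le> 1 * e" by simp
qed

lemma H_space_L2_eqI:
  assumes L: "L > 0" and uv: "u \<in> H_space L" "v \<in> H_space L" "\<And>k. fourier L u k = fourier L v k"
  shows "L2_eq L u v"
proof -
  have "L2_norm L (\<lambda>x. u x - v x) = 0"
    using assms by (intro H_space_fourier_unique) (auto simp: fourier_diff H_space_diff H_space_L2)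
  then show ?thesis
    using L2_norm_eq_0_iff[OF L2_space_diff[OF uv(1,2)[THEN H_space_L2]]] by (simp add: L2_eq_def)
qed

lemma H_space_L2_norm_cong:
  assumes L: "L > 0" and uv: "u \<in> H_space L" "v \<in> H_space L" "\<And>k. fourier L u k = fourier L v k"
  shows "L2_norm L u = L2_norm L v"
  using assms by (intro L2_norm_cong_AE H_space_L2_eqI H_space_L2)

section \<open>Fields with rapidly decreasing coefficients\<close>

text \<open>The index of a wave vector \<open>k\<close> grows like \<open>|k|\<^sup>2\<close>, so lattice sums with summands
  \<open>O(|k|\<^sup>-\<^sup>4)\<close> reduce to \<open>\<Sum>n. 1 / (n + 1)\<^sup>2\<close>.\<close>

definition wave_index :: "int^2 \<Rightarrow> nat" where
  "wave_index k = prod_encode (int_encode (k $ 1), int_encode (k $ 2))"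

definition nth_wave :: "nat \<Rightarrow> int^2" where
  "nth_wave n = (\<chi> j. int_decode ((if j = 1 then fst else snd) (prod_decode n)))"

lemma nth_wave_index [simp]: "nth_wave (wave_index k) = k"
  by (simp add: vec_eq_iff forall_2 nth_wave_def wave_index_def)

lemma wave_index_nth [simp]: "wave_index (nth_wave n) = n"
  by (simp add: nth_wave_def wave_index_def)

lemma nth_wave_eq_iff: "nth_wave n = k \<longleftrightarrow> n = wave_index k"
  by auto

lemma int_encode_le: "real (int_encode i) \<le> 2 * \<bar>of_int i\<bar>"
  by (auto simp: int_encode_def sum_encode_def)

lemma component_le_norm_wave: "\<bar>real_of_int (k $ j)\<bar> \<le> norm (wave k)"
  using component_le_norm_cart[of "wave k" j] by simp

text \<open>\<open>prod_encode (a, b)\<close> is the triangular number of \<open>a + b\<close> plus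
  \<open>a\<close>, hence quadratic in \<open>a + b\<close>. Each integer code is at most twice the
  absolute value, so \<open>a + b\<close> is at most \<open>4 * norm (wave k)\<close>, and the 16 is
  the square of this 4.\<close>

lemma Suc_wave_index_le: "real (Suc (wave_index k)) \<le> 16 * (1 + norm (wave k))\<^sup>2"
proof -
  define a b s where "a = int_encode (k $ 1)" and "b = int_encode (k $ 2)" and "s = a + b"
  have "2 * wave_index k \<le> s * Suc s + 2 * s"
    by (auto simp: wave_index_def prod_encode_def triangle_def a_def b_def s_def)
  then have "Suc (wave_index k) \<le> (s + 1)\<^sup>2"
    by (simp add: power2_eq_square)
  then have "real (Suc (wave_index k)) \<le> (real s + 1)\<^sup>2"
    by (metis (mono_tags) of_nat_1 of_nat_add of_nat_le_iff of_nat_power)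
  also have "\<dots> \<le> (4 * (1 + norm (wave k)))\<^sup>2"
    using int_encode_le[of "k $ 1"] int_encode_le[of "k $ 2"]
      component_le_norm_wave[of k 1] component_le_norm_wave[of k 2]
    by (intro power_mono) (auto simp: s_def a_def b_def)
  also have "\<dots> = 16 * (1 + norm (wave k))\<^sup>2" by (subst power_mult_distrib) simp
  finally show ?thesis by (simp only: of_nat_Suc add.commute)
qed

definition rapid :: "(int^2 \<Rightarrow> complex^2) \<Rightarrow> bool" where
  "rapid c \<longleftrightarrow> (\<forall>N. \<exists>C. \<forall>k. norm (c k) * (1 + norm (wave k)) ^ N \<le> C)"

lemma summable_rapid:
  assumes "rapid c"
  shows "summable (\<lambda>n. norm (c (nth_wave n)) * (1 + norm (wave (nth_wave n))) ^ N)"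
proof -
  \<comment> \<open>Four extra powers pay for the square of the index, which is at most
    \<open>256 * (1 + norm (wave k)) ^ 4\<close>.\<close>
  obtain C where C: "\<And>k. norm (c k) * (1 + norm (wave k)) ^ (N + 4) \<le> C"
    using assms unfolding rapid_def by blast
  have C0: "0 \<le> C" using order_trans[OF _ C[of 0]] by simp
  have "norm (c k) * (1 + norm (wave k)) ^ N \<le> 256 * C * (1 / (real (wave_index k) + 1)\<^sup>2)" for k
  proof -
    let ?w = "1 + norm (wave k)" and ?n = "real (wave_index k) + 1"
    have w: "?w > 0" by (simp add: add_pos_nonneg)
    have "?n\<^sup>2 \<le> (16 * ?w\<^sup>2)\<^sup>2"
      using Suc_wave_index_le[of k] by (intro power_mono) auto
    then have "norm (c k) * ?w ^ N * ?n\<^sup>2 \<le> norm (c k) * ?w ^ N * (16 * ?w\<^sup>2)\<^sup>2"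
      using w by (intro mult_left_mono) auto
    also have "\<dots> = 256 * (norm (c k) * ?w ^ (N + 4))"
      by (simp add: power_add power_mult_distrib flip: power_mult)
    also have "\<dots> \<le> 256 * C" using C by simp
    finally show ?thesis by (simp add: field_simps add_pos_nonneg)
  qed
  from this[of "nth_wave _"] show ?thesis
    by (intro summable_comparison_test'[OF summable_mult[OF sums_summable[OF inverse_squares_sums]]])
       (auto simp: add.commute)
qed

text \<open>Factors of polynomial growth preserve rapid decay; this serves derivatives, powers of
  the Stokes operator and the witness for the category argument.\<close>

lemma rapid_bounded_by:
  assumes "rapid c" and "\<And>k. norm (d k) \<le> C * (1 + norm (wave k)) ^ N * norm (c k)" and "C \<ge> 0"
  shows "rapid d"
  unfolding rapid_def
proof
  fix M
  obtain D where D: "\<And>k. norm (c k) * (1 + norm (wave k)) ^ (N + M) \<le> D"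
    using assms unfolding rapid_def by blast
  have "norm (d k) * (1 + norm (wave k)) ^ M \<le> C * D" for k
  proof -
    have "norm (d k) * (1 + norm (wave k)) ^ M \<le> C * (1 + norm (wave k)) ^ N * norm (c k) * (1 + norm (wave k)) ^ M"
      by (intro mult_right_mono assms) simp
    also have "\<dots> = C * (norm (c k) * (1 + norm (wave k)) ^ (N + M))"
      by (simp add: power_add)
    also have "\<dots> \<le> C * D" by (intro mult_left_mono D assms)
    finally show ?thesis .
  qed
  then show "\<exists>C. \<forall>k. norm (d k) * (1 + norm (wave k)) ^ M \<le> C" by blast
qed

lemma norm_vector_smult: "norm (z *s a) = norm z * norm a" for a :: "complex^'n"
  by (simp add: norm_vec_def L2_set_def norm_mult power_mult_distrib real_sqrt_mult flip: sum_distrib_left)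

lemma rapid_deriv:
  assumes "L > 0" "rapid c"
  shows "rapid (\<lambda>k. (\<i> * of_real (kappa0 L * of_int (k $ j))) *s c k)"
proof (rule rapid_bounded_by[OF assms(2), where N = 1])
  fix k
  have "norm ((\<i> * of_real (kappa0 L * of_int (k $ j))) *s c k) = kappa0 L * \<bar>of_int (k $ j)\<bar> * norm (c k)"
    using kappa0_pos[OF assms(1)] by (simp add: norm_vector_smult norm_mult abs_mult)
  also have "\<dots> \<le> kappa0 L * (1 + norm (wave k)) * norm (c k)"
    using kappa0_pos[OF assms(1)] component_le_norm_wave[of k j]
    by (intro mult_right_mono mult_left_mono) auto
  finally show "norm ((\<i> * of_real (kappa0 L * of_int (k $ j))) *s c k) \<le> kappa0 L * (1 + norm (wave k)) ^ 1 * norm (c k)"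
    by simp
qed (use kappa0_pos[OF assms(1)] in simp)

text \<open>The Fourier series summed along the enumeration of the lattice. Both \<open>k\<close>
  and \<open>- k\<close> are visited, so for conjugate-symmetric coefficients the half amplitudes of
  the modes add up to the usual series.\<close>

definition synth :: "real \<Rightarrow> (int^2 \<Rightarrow> complex^2) \<Rightarrow> real^2 \<Rightarrow> real^2" where
  "synth L c x = (\<Sum>n. mode L (nth_wave n) (c (nth_wave n)) x)"

text \<open>The quantitative Weierstrass test: the right-hand side depends on the majorant alone, so
  convergence is uniform in any parameter of \<open>f\<close>.\<close>

lemma norm_suminf_tail_le:
  fixes f :: "nat \<Rightarrow> 'a :: banach"
  assumes "summable M" "\<And>i. norm (f i) \<le> M i"
  shows "norm (sum f {..<n} - suminf f) \<le> suminf M - sum M {..<n}"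
proof -
  have f: "summable f" "summable (\<lambda>i. norm (f i))"
    using assms by (auto intro: summable_comparison_test' summable_norm_comparison_test)
  have "norm (sum f {..<n} - suminf f) = norm (\<Sum>i. f (i + n))"
    by (subst suminf_split_initial_segment[OF f(1), of n]) (simp add: norm_minus_commute)
  also have "\<dots> \<le> (\<Sum>i. norm (f (i + n)))"
    by (intro summable_norm summable_ignore_initial_segment f)
  also have "\<dots> \<le> (\<Sum>i. M (i + n))"
    by (intro suminf_le assms summable_ignore_initial_segment f)
  also have "\<dots> = suminf M - sum M {..<n}"
    using suminf_minus_initial_segment[OF assms(1)] .
  finally show ?thesis .
qed

lemma tail_tendsto_0:
  fixes M :: "nat \<Rightarrow> real"
  assumes "summable M"
  shows "(\<lambda>n. suminf M - sum M {..<n}) \<longlonglongrightarrow> 0"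
  using tendsto_diff[OF tendsto_const summable_LIMSEQ[OF assms], of "suminf M"] by simp

lemma summable_norm_rapid: "rapid c \<Longrightarrow> summable (\<lambda>n. norm (c (nth_wave n)))"
  using summable_rapid[of c 0] by simp

lemma synth_sums:
  assumes "rapid c"
  shows "(\<lambda>n. mode L (nth_wave n) (c (nth_wave n)) x) sums synth L c x"
  unfolding synth_def
  by (intro summable_sums summable_comparison_test'[OF summable_norm_rapid[OF assms]] norm_mode_le)

text \<open>Termwise differentiation: the derivatives of the modes, applied to \<open>h\<close>, are
  dominated by a summable sequence times \<open>norm h\<close>, uniformly in \<open>x\<close>. The
  derivative is again a synthesised field, which makes induction on the order of smoothness
  possible.\<close>

lemma
  assumes L: "L > 0" and c: "rapid c"
  shows differentiable_synth: "synth L c differentiable (at x)"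
    and pderiv_at_synth: "pderiv_at j (synth L c) = synth L (\<lambda>k. (\<i> * of_real (kappa0 L * of_int (k $ j))) *s c k)"
proof -
  let ?K = "kappa0 L" and ?e = nth_wave
  let ?f' = "\<lambda>n x h. (?K * (wave (?e n) \<bullet> h)) *\<^sub>R mode L (?e n) (\<i> *s c (?e n)) x"
  let ?M = "\<lambda>n. ?K * (norm (c (?e n)) * (1 + norm (wave (?e n))) ^ 1)"
  have K: "?K > 0" using L by simp
  have M: "summable ?M" by (intro summable_mult summable_rapid c)
  have f'_le: "norm (?f' n x h) \<le> ?M n * norm h" for n x h
  proof -
    have "\<bar>?K * (wave (?e n) \<bullet> h)\<bar> \<le> ?K * (norm (wave (?e n)) * norm h)"
      using K Cauchy_Schwarz_ineq2[of "wave (?e n)" h] by (simp add: abs_mult)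
    then have "norm (?f' n x h) \<le> ?K * (norm (wave (?e n)) * norm h) * norm (\<i> *s c (?e n))"
      unfolding norm_scaleR using K by (intro mult_mono norm_mode_le) auto
    also have "\<dots> \<le> ?M n * norm h"
      using K by (simp add: norm_vector_smult algebra_simps)
    finally show ?thesis .
  qed
  have "\<exists>g. \<forall>x\<in>UNIV. (\<lambda>n. mode L (?e n) (c (?e n)) x) sums g x \<and>
      (g has_derivative (\<lambda>h. \<Sum>n. ?f' n x h)) (at x)"
  proof (rule has_derivative_series[where x = 0])
    fix e :: real assume "e > 0"
    then have "eventually (\<lambda>n. suminf ?M - sum ?M {..<n} < e) sequentially"
      by (rule order_tendstoD(2)[OF tail_tendsto_0[OF M]])
    then show "\<forall>\<^sub>F n in sequentially. \<forall>x\<in>UNIV. \<forall>h. norm ((\<Sum>i<n. ?f' i x h) - (\<Sum>n. ?f' n x h)) \<le> e * norm h"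
    proof eventually_elim
      case (elim n)
      show ?case
      proof (intro ballI allI)
        fix x h :: "real^2"
        have "norm ((\<Sum>i<n. ?f' i x h) - (\<Sum>n. ?f' n x h)) \<le> (\<Sum>i. ?M i * norm h) - (\<Sum>i<n. ?M i * norm h)"
          by (intro norm_suminf_tail_le summable_mult2 M f'_le)
        also have "\<dots> = (suminf ?M - sum ?M {..<n}) * norm h"
          by (simp only: suminf_mult2[OF M, symmetric] sum_distrib_right[symmetric] left_diff_distrib)
        also have "\<dots> \<le> e * norm h" using elim by (intro mult_right_mono) auto
        finally show "norm ((\<Sum>i<n. ?f' i x h) - (\<Sum>n. ?f' n x h)) \<le> e * norm h" .
      qed
    qed
  qed (auto intro: mode_has_derivative synth_sums[OF c])
  then obtain g where g: "\<And>x. (\<lambda>n. mode L (?e n) (c (?e n)) x) sums g x"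
    "\<And>x. (g has_derivative (\<lambda>h. \<Sum>n. ?f' n x h)) (at x)" by blast
  have "g = synth L c" using g(1) synth_sums[OF c] by (intro ext) (rule sums_unique2)
  with g(2) have d: "(synth L c has_derivative (\<lambda>h. \<Sum>n. ?f' n x h)) (at x)" for x by simp
  show "synth L c differentiable (at x)" by (rule differentiableI[OF d])
  show "pderiv_at j (synth L c) = synth L (\<lambda>k. (\<i> * of_real (?K * of_int (k $ j))) *s c k)"
    using pderiv_atI[OF d] by (intro ext) (simp add: synth_def mode_scaleR vector_smult_assoc mult.commute)
qed

lemma smooth_synth:
  assumes L: "L > 0" and "rapid c"
  shows "smooth (synth L c)"
proof -
  have "C_k n (synth L c)" for n
    using assms(2)
  proof (induction n arbitrary: c)
    case 0
    then show ?case
      using differentiable_synth[OF L]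
      by (simp add: differentiable_imp_continuous_within continuous_on_eq_continuous_within)
  next
    case (Suc n)
    then show ?case using differentiable_synth[OF L] rapid_deriv[OF L] by (simp add: pderiv_at_synth[OF L])
  qed
  then show ?thesis by (simp add: smooth_def)
qed

lemma periodic_synth: "L > 0 \<Longrightarrow> periodic L (synth L c)"
  using periodic_mode[of L] by (simp add: periodic_def synth_def)

lemma L2_norm_le_sup:
  assumes "L > 0" "u \<in> L2_space L" "\<And>x. norm (u x) \<le> B"
  shows "L2_norm L u \<le> B * L"
proof (rule power2_le_imp_le)
  have B: "B \<ge> 0" using order_trans[OF norm_ge_zero assms(3)] .
  interpret finite_measure "lebesgue_on (Omega L)" by (rule finite_measure_Omega)
  have "(L2_norm L u)\<^sup>2 \<le> integral\<^sup>L (lebesgue_on (Omega L)) (\<lambda>x. B\<^sup>2)"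
    unfolding L2_norm_sq using assms
    by (intro integral_mono) (auto simp: L2_space_def intro: power_mono)
  also have "\<dots> = (B * L)\<^sup>2"
    using integral_const_Omega[OF assms(1), of "B\<^sup>2"] by (simp add: power_mult_distrib)
  finally show "(L2_norm L u)\<^sup>2 \<le> (B * L)\<^sup>2" .
  show "0 \<le> B * L" using B assms(1) by simp
qed

definition synth_part :: "real \<Rightarrow> (int^2 \<Rightarrow> complex^2) \<Rightarrow> nat \<Rightarrow> real^2 \<Rightarrow> real^2" where
  "synth_part L c N x = (\<Sum>n<N. mode L (nth_wave n) (c (nth_wave n)) x)"

lemma synth_part_L2: "L > 0 \<Longrightarrow> synth_part L c N \<in> L2_space L"
  unfolding synth_part_def by (intro L2_space_continuous smooth_continuous smooth_sum_mode) auto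

lemma synth_L2: "L > 0 \<Longrightarrow> rapid c \<Longrightarrow> synth L c \<in> L2_space L"
  by (intro L2_space_continuous smooth_continuous smooth_synth)

lemma synth_part_tendsto:
  assumes "L > 0" "rapid c"
  shows "(\<lambda>N. L2_norm L (\<lambda>x. synth L c x - synth_part L c N x)) \<longlonglongrightarrow> 0"
proof (rule tendsto_sandwich[OF _ _ tendsto_const])
  let ?M = "\<lambda>n. norm (c (nth_wave n))"
  note M = summable_norm_rapid[OF assms(2)]
  show "(\<lambda>N. (suminf ?M - sum ?M {..<N}) * L) \<longlonglongrightarrow> 0"
    using tendsto_mult_right[OF tail_tendsto_0[OF M], of L] by simp
  show "\<forall>\<^sub>F N in sequentially. L2_norm L (\<lambda>x. synth L c x - synth_part L c N x) \<le> (suminf ?M - sum ?M {..<N}) * L"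
  proof (intro always_eventually allI L2_norm_le_sup assms L2_space_diff synth_L2 synth_part_L2)
    fix N x
    show "norm (synth L c x - synth_part L c N x) \<le> suminf ?M - sum ?M {..<N}"
      using norm_suminf_tail_le[OF M, of "\<lambda>n. mode L (nth_wave n) (c (nth_wave n)) x" N]
      by (simp add: norm_mode_le synth_def synth_part_def norm_minus_commute)
  qed
qed auto

text \<open>The partial sums are the approximants that the definition of \<open>H_space\<close> asks
  for. Each mode is real and solenoidal by itself, so the order of the enumeration does not
  matter.\<close>

lemma synth_H_space:
  assumes L: "L > 0" and c: "rapid c" "solenoidal_coeffs c"
  shows "synth L c \<in> H_space L"
  unfolding H_space_def
proof (intro CollectI conjI allI impI synth_L2 L c)
  have part: "synth_part L c N \<in> solenoidal_polys L" for N
  proof (induction N)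
    case 0
    then show ?case by (simp add: synth_part_def[abs_def] solenoidal_polys_zero)
  next
    case (Suc N)
    have "mode L (nth_wave N) (c (nth_wave N)) \<in> solenoidal_polys L"
      using c(2) by (intro solenoidal_polys_mode L) (auto simp: solenoidal_coeffs_def)
    from solenoidal_polys_add[OF L Suc this] show ?case by (simp add: synth_part_def[abs_def])
  qed
  fix e :: real assume "e > 0"
  then have "eventually (\<lambda>N. L2_norm L (\<lambda>x. synth L c x - synth_part L c N x) < e) sequentially"
    by (rule order_tendstoD(2)[OF synth_part_tendsto[OF L c(1)]])
  then obtain N where "L2_norm L (\<lambda>x. synth L c x - synth_part L c N x) < e"
    using eventually_happens'[OF sequentially_bot] by blast
  then show "\<exists>v\<in>solenoidal_polys L. L2_norm L (\<lambda>x. synth L c x - v x) < e"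
    using part by blast
qed

lemma fourier_synth:
  assumes L: "L > 0" and c: "rapid c" "solenoidal_coeffs c"
  shows "fourier L (synth L c) k = c k"
  unfolding vec_eq_iff
proof
  fix j
  let ?F = "\<lambda>N. fourier L (synth_part L c N) k $ j"
  have part: "?F N = (\<Sum>n<N. ((if n = wave_index k then c k $ j else 0)
      + (if n = wave_index (- k) then cnj (c (- k) $ j) else 0)) / 2)" for N
  proof (induction N)
    case 0
    then show ?case by (simp add: synth_part_def[abs_def])
  next
    case (Suc N)
    have "synth_part L c (Suc N) = (\<lambda>x. synth_part L c N x + mode L (nth_wave N) (c (nth_wave N)) x)"
      by (simp add: synth_part_def[abs_def])
    then have "?F (Suc N) = ?F N + fourier L (mode L (nth_wave N) (c (nth_wave N))) k $ j"
      using fourier_add[OF synth_part_L2[OF L] mode_L2] by simp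
    moreover have "(if nth_wave N = k then c (nth_wave N) $ j else 0) = (if N = wave_index k then c k $ j else 0)"
      "(if nth_wave N = - k then cnj (c (nth_wave N) $ j) else 0)
        = (if N = wave_index (- k) then cnj (c (- k) $ j) else 0)"
      by (auto simp: nth_wave_eq_iff)
    ultimately show ?case
      unfolding Suc fourier_mode[OF L] by (simp only: sum.lessThan_Suc)
  qed
  \<comment> \<open>Beyond both indices the two half amplitudes are present, and the reality
    constraint makes them equal. The coefficient is then constant in \<open>N\<close>, which gives
    its limit.\<close>
  have eq: "?F N = c k $ j" if "N > wave_index k" "N > wave_index (- k)" for N
  proof -
    have "?F N = (c k $ j + cnj (c (- k) $ j)) / 2"
      unfolding part sum_divide_distrib[symmetric] sum.distrib using that by (simp add: sum.delta)
    then show ?thesis using c(2) by (simp add: solenoidal_coeffs_def)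
  qed
  have "eventually (\<lambda>N. ?F N = c k $ j) sequentially"
    using eventually_gt_at_top[of "wave_index k"] eventually_gt_at_top[of "wave_index (- k)"]
    by eventually_elim (rule eq)
  then have lim1: "?F \<longlonglongrightarrow> c k $ j" by (rule tendsto_eventually)
  have lim2: "(\<lambda>N. fourier L (synth L c) k $ j - ?F N) \<longlonglongrightarrow> 0"
  proof (rule Lim_null_comparison)
    show "(\<lambda>N. L2_norm L (\<lambda>x. synth L c x - synth_part L c N x) / L) \<longlonglongrightarrow> 0"
      using tendsto_divide[OF synth_part_tendsto[OF L c(1)] tendsto_const, of L] L by simp
    show "\<forall>\<^sub>F N in sequentially. norm (fourier L (synth L c) k $ j - ?F N)
        \<le> L2_norm L (\<lambda>x. synth L c x - synth_part L c N x) / L"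
      using norm_fourier_component_le[OF L L2_space_diff[OF synth_L2[OF L c(1)] synth_part_L2[OF L]]]
      by (simp add: fourier_diff[OF synth_L2[OF L c(1)] synth_part_L2[OF L]])
  qed
  have "?F \<longlonglongrightarrow> fourier L (synth L c) k $ j"
    using tendsto_diff[OF tendsto_const[of "fourier L (synth L c) k $ j"] lim2] by simp
  then show "fourier L (synth L c) k $ j = c k $ j"
    using lim1 by (rule LIMSEQ_unique)
qed

lemma synth_F_space: "L > 0 \<Longrightarrow> rapid c \<Longrightarrow> solenoidal_coeffs c \<Longrightarrow> synth L c \<in> F_space L"
  by (simp add: F_space_def synth_H_space smooth_synth periodic_synth)

section \<open>Fourier multipliers and the classes \<open>\<C>(\<sigma>)\<close> and \<open>E\<^sub>b\<close>\<close>

lemma smooth_pderiv_funpow: "smooth u \<Longrightarrow> smooth ((pderiv_at j ^^ N) u)"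
  by (induction N) (auto intro: smooth_pderiv_at)

lemma periodic_pderiv_funpow: "smooth u \<Longrightarrow> periodic L u \<Longrightarrow> periodic L ((pderiv_at j ^^ N) u)"
  by (induction N) (auto intro: periodic_pderiv_at smooth_pderiv_funpow)

lemma fourier_pderiv_funpow:
  assumes "L > 0" "smooth u" "periodic L u"
  shows "fourier L ((pderiv_at j ^^ N) u) k = (\<i> * of_real (kappa0 L * of_int (k $ j))) ^ N *s fourier L u k"
  using assms
  by (induction N) (simp_all add: fourier_pderiv_at smooth_pderiv_funpow periodic_pderiv_funpow vector_smult_assoc)

lemma power_one_plus_le:
  fixes x y :: real
  assumes "0 \<le> x" "0 \<le> y"
  shows "(1 + (x + y)) ^ N \<le> 3 ^ N * (1 + x ^ N + y ^ N)"
proof -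
  let ?m = "max 1 (max x y)"
  have "(1 + (x + y)) ^ N \<le> (3 * ?m) ^ N"
    using assms by (intro power_mono) auto
  also have "\<dots> = 3 ^ N * ?m ^ N" by (simp add: power_mult_distrib)
  also have "\<dots> \<le> 3 ^ N * (1 + x ^ N + y ^ N)"
    using assms by (intro mult_left_mono) (auto simp: max_def)
  finally show ?thesis .
qed

text \<open>Pure \<open>N\<close>-th derivatives in the two coordinate directions bound
  \<open>|k $ j| ^ N\<close> times the coefficient, and \<open>(1 + norm (wave k)) ^ N\<close> is
  controlled by these two powers and 1; mixed derivatives do not occur.\<close>

lemma rapid_fourier:
  assumes L: "L > 0" and u: "smooth u" "periodic L u"
  shows "rapid (fourier L u)"
  unfolding rapid_def
proof
  fix N
  define B where "B j = 2 * L2_norm L ((pderiv_at j ^^ N) u) / L / kappa0 L ^ N" for j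
  have B: "norm (fourier L u k) * \<bar>of_int (k $ j)\<bar> ^ N \<le> B j" for k j
  proof -
    have "norm (fourier L ((pderiv_at j ^^ N) u) k) \<le> 2 * L2_norm L ((pderiv_at j ^^ N) u) / L"
      by (intro norm_fourier_le L L2_space_continuous smooth_continuous smooth_pderiv_funpow u)
    then have "norm (fourier L u k) * \<bar>of_int (k $ j)\<bar> ^ N * kappa0 L ^ N \<le> 2 * L2_norm L ((pderiv_at j ^^ N) u) / L"
      using kappa0_pos[OF L] unfolding fourier_pderiv_funpow[OF L u]
      by (simp add: norm_vector_smult norm_power norm_mult power_mult_distrib abs_mult mult_ac)
    then show ?thesis
      using kappa0_pos[OF L] unfolding B_def by (subst pos_le_divide_eq) auto
  qed
  have "norm (fourier L u k) * (1 + norm (wave k)) ^ N \<le> 3 ^ N * (2 * L2_norm L u / L + B 1 + B 2)" for k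
  proof -
    have "norm (wave k) \<le> \<bar>of_int (k $ 1)\<bar> + \<bar>of_int (k $ 2)\<bar>"
      using norm_le_l1_cart[of "wave k"] by (simp add: sum_2)
    then have "(1 + norm (wave k)) ^ N \<le> (1 + (\<bar>of_int (k $ 1)\<bar> + \<bar>of_int (k $ 2)\<bar>)) ^ N"
      by (intro power_mono) auto
    also have "\<dots> \<le> 3 ^ N * (1 + \<bar>of_int (k $ 1)\<bar> ^ N + \<bar>of_int (k $ 2)\<bar> ^ N)"
      by (rule power_one_plus_le) auto
    finally have "norm (fourier L u k) * (1 + norm (wave k)) ^ N
        \<le> norm (fourier L u k) * (3 ^ N * (1 + \<bar>of_int (k $ 1)\<bar> ^ N + \<bar>of_int (k $ 2)\<bar> ^ N))"
      by (rule mult_left_mono) simp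
    also have "\<dots> = 3 ^ N * (norm (fourier L u k) + norm (fourier L u k) * \<bar>of_int (k $ 1)\<bar> ^ N
        + norm (fourier L u k) * \<bar>of_int (k $ 2)\<bar> ^ N)"
      by (simp add: algebra_simps)
    also have "\<dots> \<le> 3 ^ N * (2 * L2_norm L u / L + B 1 + B 2)"
      by (intro mult_left_mono add_mono B norm_fourier_le L L2_space_continuous smooth_continuous u) simp
    finally show ?thesis .
  qed
  then show "\<exists>C. \<forall>k. norm (fourier L u k) * (1 + norm (wave k)) ^ N \<le> C" by blast
qed

section \<open>Operators given by multiplying Fourier coefficients\<close>

lemma is_mult_mult_op: "is_mult L m u w \<Longrightarrow> is_mult L m u (mult_op L m u)"
  unfolding mult_op_def by (rule someI[of "is_mult L m u"])

lemma solenoidal_coeffs_scaleR: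
  assumes "solenoidal_coeffs c" "\<And>k. m (- k) = m k"
  shows "solenoidal_coeffs (\<lambda>k. (m k :: real) *\<^sub>R c k)"
  unfolding solenoidal_coeffs_def
proof (intro conjI allI)
  fix k
  have "(\<Sum>j\<in>UNIV. of_int (k $ j) * (m k *\<^sub>R c k) $ j) = m k *\<^sub>R (\<Sum>j\<in>UNIV. of_int (k $ j) * c k $ j)"
    by (simp add: scaleR_sum_right)
  then show "(\<Sum>j\<in>UNIV. of_int (k $ j) * (m k *\<^sub>R c k) $ j) = 0"
    using assms(1) by (simp add: solenoidal_coeffs_def)
qed (use assms in \<open>auto simp: solenoidal_coeffs_def\<close>)

text \<open>Supplies an explicit value of the multiplier. Evenness of \<open>m\<close> is what
  preserves conjugate symmetry, hence real-valuedness.\<close>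

lemma is_mult_synth:
  assumes L: "L > 0" and u: "u \<in> H_space L" and m: "\<And>k. m (- k) = m k"
    and r: "rapid (\<lambda>k. m k *\<^sub>R fourier L u k)"
  shows "is_mult L m u (synth L (\<lambda>k. m k *\<^sub>R fourier L u k))"
proof -
  have "solenoidal_coeffs (\<lambda>k. m k *\<^sub>R fourier L u k)"
    by (intro solenoidal_coeffs_scaleR solenoidal_coeffs_fourier L u m)
  with L r show ?thesis by (simp add: is_mult_def synth_H_space fourier_synth)
qed

lemma stokes_symbol_uminus [simp]: "stokes_symbol L s (- k) = stokes_symbol L s k"
  by (simp add: stokes_symbol_def)

lemma norm_wave_ge_1:
  assumes "k \<noteq> 0"
  shows "1 \<le> norm (wave k)"
proof -
  obtain j where "k $ j \<noteq> 0" using assms by (auto simp: vec_eq_iff)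
  then have "1 \<le> \<bar>real_of_int (k $ j)\<bar>" by linarith
  also have "\<dots> \<le> norm (wave k)" by (rule component_le_norm_wave)
  finally show ?thesis .
qed

text \<open>At \<open>k = 0\<close> and \<alpha> = 0 the two sides differ, since
  \<open>0 powr 0 = 0\<close> but \<open>0 ^ 0 = 1\<close>; elements of \<open>H_space\<close> have
  no coefficient there.\<close>

lemma stokes_symbol_half_nat:
  assumes "L > 0" "k \<noteq> 0"
  shows "stokes_symbol L (real \<alpha> / 2) k = (kappa0 L * norm (wave k)) ^ \<alpha>"
proof -
  have "kappa0 L * norm (wave k) > 0"
    using kappa0_pos[OF assms(1)] norm_wave_ge_1[OF assms(2)] by (intro mult_pos_pos) auto
  then show ?thesis by (simp add: stokes_symbol_def powr_realpow)
qed

lemma is_mult_stokes_pow: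
  assumes L: "L > 0" and u: "u \<in> F_space L"
  shows "is_mult L (stokes_symbol L (real \<alpha> / 2)) u (stokes_pow L (real \<alpha> / 2) u)"
proof -
  let ?m = "stokes_symbol L (real \<alpha> / 2)"
  have uH: "u \<in> H_space L" using u by (simp add: F_space_def)
  have f0: "fourier L u 0 = 0" using solenoidal_coeffs_fourier[OF L uH] by (simp add: solenoidal_coeffs_def)
  have "rapid (\<lambda>k. ?m k *\<^sub>R fourier L u k)"
  proof (rule rapid_bounded_by)
    show "rapid (fourier L u)" using u by (intro rapid_fourier L) (auto simp: F_space_def)
    fix k
    show "norm (?m k *\<^sub>R fourier L u k) \<le> kappa0 L ^ \<alpha> * (1 + norm (wave k)) ^ \<alpha> * norm (fourier L u k)"
    proof (cases "k = 0")
      case False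
      have "?m k \<le> kappa0 L ^ \<alpha> * (1 + norm (wave k)) ^ \<alpha>"
        unfolding stokes_symbol_half_nat[OF L False] power_mult_distrib[symmetric]
        using kappa0_pos[OF L] by (intro power_mono mult_left_mono) auto
      moreover have "?m k \<ge> 0" by (simp add: stokes_symbol_def)
      ultimately show ?thesis by (simp add: mult_right_mono)
    qed (simp add: f0)
  qed (use kappa0_pos[OF L] in simp)
  then show ?thesis
    unfolding stokes_pow_def by (intro is_mult_mult_op[OF is_mult_synth] L uH) auto
qed

lemma E_symbol_uminus [simp]: "E_symbol b (- k) = E_symbol b k"
  by (simp add: E_symbol_def)

lemma E_symbol_pos [simp]: "E_symbol b k > 0"
  by (simp add: E_symbol_def)

text \<open>With \<open>t = ln (norm (wave k) + exp 1)\<close> this is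
  \<open>N * t \<le> N\<^sup>2 / (4 * b) + b * t\<^sup>2\<close>, obtained by completing the
  square.\<close>

lemma power_le_E_symbol:
  assumes "b > 0"
  shows "(1 + norm (wave k)) ^ N \<le> exp ((real N)\<^sup>2 / (4 * b)) * E_symbol b k"
proof -
  let ?x = "norm (wave k) + exp 1" and ?N = "real N"
  have x: "1 \<le> ?x" using exp_ge_add_one_self[of 1] norm_ge_zero[of "wave k"] by (smt (verit))
  define t where "t = ln ?x"
  have "(1 + norm (wave k)) ^ N \<le> ?x ^ N"
    using exp_ge_add_one_self[of 1] by (intro power_mono) auto
  also have "\<dots> = exp (?N * t)"
    using x by (simp add: t_def exp_of_nat_mult)
  also have "?N * t \<le> ?N\<^sup>2 / (4 * b) + b * t\<^sup>2"
  proof -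
    have "0 \<le> (?N - 2 * b * t)\<^sup>2 / (4 * b)" using assms by simp
    also have "\<dots> = ?N\<^sup>2 / (4 * b) - ?N * t + b * t\<^sup>2"
      using assms by (simp add: field_simps power2_eq_square)
    finally show ?thesis by simp
  qed
  also have "exp \<dots> = exp (?N\<^sup>2 / (4 * b)) * E_symbol b k"
    by (simp add: exp_add E_symbol_def t_def)
  finally show ?thesis by simp
qed

text \<open>One symbol factor absorbs every power of the wave number. The lemma yields smooth
  representatives of \<open>E_space\<close>, the convergence of \<open>E\<^sup>b g\<close>, and the
  smoothness of the category witness.\<close>

lemma rapid_of_E_bound:
  assumes b: "b > 0" and c: "\<And>k. E_symbol b k * norm (c k) \<le> B"
  shows "rapid c"
  unfolding rapid_def
proof
  fix N
  have "norm (c k) * (1 + norm (wave k)) ^ N \<le> exp ((real N)\<^sup>2 / (4 * b)) * B" for k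
  proof -
    have "norm (c k) * (1 + norm (wave k)) ^ N \<le> norm (c k) * (exp ((real N)\<^sup>2 / (4 * b)) * E_symbol b k)"
      by (intro mult_left_mono power_le_E_symbol b) simp
    also have "\<dots> = exp ((real N)\<^sup>2 / (4 * b)) * (E_symbol b k * norm (c k))" by simp
    also have "\<dots> \<le> exp ((real N)\<^sup>2 / (4 * b)) * B" by (intro mult_left_mono c) simp
    finally show ?thesis .
  qed
  then show "\<exists>C. \<forall>k. norm (c k) * (1 + norm (wave k)) ^ N \<le> C" by blast
qed

lemma E_norm_bound:
  assumes L: "L > 0" and u: "E_norm L b u \<le> ennreal r" and r: "r \<ge> 0"
  shows "E_symbol b k * norm (fourier L u k) \<le> 2 * r / L"
proof -
  let ?w = "mult_op L (E_symbol b) u"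
  \<comment> \<open>Finiteness of the extended norm excludes its infinite branch, so the chosen
    value of the operator is a genuine one.\<close>
  have dom: "u \<in> mult_dom L (E_symbol b)"
    using u by (auto simp: E_norm_def top_unique split: if_splits)
  then have w: "is_mult L (E_symbol b) u ?w"
    unfolding mult_dom_def by (auto intro: is_mult_mult_op)
  have "L2_norm L ?w \<le> r" using u dom r by (simp add: E_norm_def)
  then have "norm (fourier L ?w k) \<le> 2 * r / L"
    using norm_fourier_le[OF L, of ?w k] w L
    by (smt (verit) H_space_L2 divide_right_mono is_mult_def)
  then show ?thesis using w by (simp add: is_mult_def abs_of_pos)
qed

lemma E_norm_le_nat:
  assumes "u \<in> E_space L b"
  obtains n where "1 \<le> n" "E_norm L b u \<le> of_nat n"
proof -
  have "E_norm L b u < \<infinity>" using assms by (simp add: E_space_def)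
  then obtain r where r: "r \<ge> 0" "E_norm L b u = ennreal r"
    by (metis ennreal_cases infinity_ennreal_def less_irrefl)
  have "r \<le> real (Suc (nat \<lceil>r\<rceil>))" using of_nat_ceiling[of r] by simp
  then have "E_norm L b u \<le> of_nat (Suc (nat \<lceil>r\<rceil>))"
    unfolding r(2) ennreal_of_nat_eq_real_of_nat by (rule ennreal_leI)
  then show ?thesis using that[of "Suc (nat \<lceil>r\<rceil>)"] by simp
qed

text \<open>This places \<open>E_space\<close> inside \<open>F_space\<close> up to null sets and
  thus gives meaning to its category there.\<close>

lemma E_space_F_space_representative:
  assumes L: "L > 0" and b: "b > 0" and u: "u \<in> E_space L b"
  shows "\<exists>w\<in>F_space L. L2_eq L u w"
proof
  obtain n where "E_norm L b u \<le> of_nat n" using E_norm_le_nat[OF u] .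
  then have "E_symbol b k * norm (fourier L u k) \<le> 2 * real n / L" for k
    by (intro E_norm_bound L) (auto simp: ennreal_of_nat_eq_real_of_nat)
  then have r: "rapid (fourier L u)" by (rule rapid_of_E_bound[OF b])
  have uH: "u \<in> H_space L" using u by (simp add: E_space_def)
  note c = solenoidal_coeffs_fourier[OF L uH]
  show "synth L (fourier L u) \<in> F_space L" by (rule synth_F_space[OF L r c])
  show "L2_eq L u (synth L (fourier L u))"
    by (intro H_space_L2_eqI L uH synth_H_space r c) (simp add: fourier_synth[OF L r c])
qed

lemma ln_plus_exp_1_le:
  fixes x :: real
  assumes "1 \<le> x"
  shows "ln (x + exp 1) \<le> ln x + 2"
proof -
  have e: "2 \<le> exp (1::real)" using exp_ge_add_one_self[of 1] by simp
  have "x + exp 1 \<le> x * (1 + exp 1)"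
    using mult_right_mono[OF assms, of "exp 1"] by (simp add: algebra_simps)
  also have "1 + exp 1 \<le> exp (1::real) * exp 1"
    using mult_right_mono[OF e exp_ge_zero[of 1]] e by linarith
  then have "x * (1 + exp 1) \<le> x * exp 2"
    using assms by (intro mult_left_mono) (auto simp flip: exp_add)
  finally have "ln (x + exp 1) \<le> ln (x * exp 2)"
    using assms by (subst ln_le_cancel_iff) (auto simp: add_pos_pos)
  then show ?thesis using assms by (simp add: ln_mult)
qed

text \<open>The bound over all \<open>\<alpha>\<close> is optimized at \<open>\<alpha> = ln |k| / \<sigma>\<close>; rounding down to an integer costs a
  factor \<open>exp (\<sigma> / 2)\<close>.\<close>

lemma le_exp_ln_square:
  fixes x y \<sigma> D :: real
  assumes x: "1 \<le> x" and \<sigma>: "\<sigma> > 0" and D: "D \<ge> 0"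
    and bound: "\<And>\<alpha>::nat. x ^ \<alpha> * y \<le> D * exp (\<sigma> * (real \<alpha>)\<^sup>2 / 2)"
  shows "y \<le> D * exp (\<sigma> / 2 - (ln x)\<^sup>2 / (2 * \<sigma>))"
proof -
  define \<alpha> where "\<alpha> = nat \<lfloor>ln x / \<sigma>\<rfloor>"
  have a: "real \<alpha> = of_int \<lfloor>ln x / \<sigma>\<rfloor>" using x \<sigma> by (simp add: \<alpha>_def)
  have "\<bar>real \<alpha> - ln x / \<sigma>\<bar> \<le> 1" unfolding a by linarith
  then have sq: "(real \<alpha> - ln x / \<sigma>)\<^sup>2 \<le> 1" by (simp add: abs_square_le_1)
  have "x ^ \<alpha> = exp (real \<alpha> * ln x)" using x by (simp add: exp_of_nat_mult)
  then have "y \<le> D * exp (\<sigma> * (real \<alpha>)\<^sup>2 / 2) / exp (real \<alpha> * ln x)"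
    using bound[of \<alpha>] by (simp add: field_simps)
  also have "\<dots> = D * exp (\<sigma> * (real \<alpha>)\<^sup>2 / 2 - real \<alpha> * ln x)" by (simp add: exp_diff)
  also have "\<sigma> * (real \<alpha>)\<^sup>2 / 2 - real \<alpha> * ln x = \<sigma> / 2 * (real \<alpha> - ln x / \<sigma>)\<^sup>2 - (ln x)\<^sup>2 / (2 * \<sigma>)"
    using \<sigma> by (simp add: field_simps power2_eq_square)
  also have "D * exp \<dots> \<le> D * exp (\<sigma> / 2 - (ln x)\<^sup>2 / (2 * \<sigma>))"
    using sq \<sigma> D by (intro mult_left_mono) auto
  finally show ?thesis .
qed

lemma C_class_fourier_bound:
  assumes L: "L > 0" and \<sigma>: "\<sigma> > 0" and g: "g \<in> C_class L \<nu> \<sigma>"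
  obtains D where "D \<ge> 0"
    and "\<And>k. k \<noteq> 0 \<Longrightarrow> norm (fourier L g k) \<le> D * exp (\<sigma> / 2 - (ln (norm (wave k)))\<^sup>2 / (2 * \<sigma>))"
proof -
  obtain c0 where c0: "\<And>\<alpha>::nat. g \<in> stokes_dom L (real \<alpha> / 2)"
    "\<And>\<alpha>::nat. (L2_norm L (stokes_pow L (real \<alpha> / 2) g))\<^sup>2 \<le> c0 * exp (\<sigma> * (real \<alpha>)\<^sup>2) * \<nu>\<^sup>2 * kappa0 L ^ (2 * \<alpha>)"
    using g unfolding C_class_def by blast
  define D where "D = 2 * (sqrt \<bar>c0\<bar> * \<bar>\<nu>\<bar>) / L"
  have D: "D \<ge> 0" using L by (simp add: D_def)
  have K: "kappa0 L > 0" using L by simp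
  have "norm (fourier L g k) \<le> D * exp (\<sigma> / 2 - (ln (norm (wave k)))\<^sup>2 / (2 * \<sigma>))" if k: "k \<noteq> 0" for k
  proof (rule le_exp_ln_square[OF norm_wave_ge_1[OF k] \<sigma> D])
    fix \<alpha> :: nat
    let ?w = "stokes_pow L (real \<alpha> / 2) g" and ?E = "exp (\<sigma> * (real \<alpha>)\<^sup>2 / 2)"
    have w: "is_mult L (stokes_symbol L (real \<alpha> / 2)) g ?w"
      using c0(1)[of \<alpha>] unfolding stokes_dom_def stokes_pow_def mult_dom_def
      by (auto intro: is_mult_mult_op)
    have "L2_norm L ?w \<le> sqrt \<bar>c0\<bar> * \<bar>\<nu>\<bar> * ?E * kappa0 L ^ \<alpha>"
    proof (rule power2_le_imp_le)
      have "(L2_norm L ?w)\<^sup>2 \<le> c0 * (exp (\<sigma> * (real \<alpha>)\<^sup>2) * \<nu>\<^sup>2 * kappa0 L ^ (2 * \<alpha>))"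
        using c0(2)[of \<alpha>] by (simp add: mult.assoc)
      also have "\<dots> \<le> \<bar>c0\<bar> * (exp (\<sigma> * (real \<alpha>)\<^sup>2) * \<nu>\<^sup>2 * kappa0 L ^ (2 * \<alpha>))"
        using K by (intro mult_right_mono) auto
      also have "\<dots> = (sqrt \<bar>c0\<bar> * \<bar>\<nu>\<bar> * ?E * kappa0 L ^ \<alpha>)\<^sup>2"
        by (simp add: power_mult_distrib power_even_eq flip: exp_double)
      finally show "(L2_norm L ?w)\<^sup>2 \<le> (sqrt \<bar>c0\<bar> * \<bar>\<nu>\<bar> * ?E * kappa0 L ^ \<alpha>)\<^sup>2" .
    qed (use K in simp)
    then have "2 * L2_norm L ?w / L \<le> 2 * (sqrt \<bar>c0\<bar> * \<bar>\<nu>\<bar> * ?E * kappa0 L ^ \<alpha>) / L"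
      using L by (intro divide_right_mono) auto
    moreover have "norm (fourier L ?w k) \<le> 2 * L2_norm L ?w / L"
      using w by (intro norm_fourier_le L H_space_L2) (simp add: is_mult_def)
    moreover have "norm (fourier L ?w k) = kappa0 L ^ \<alpha> * (norm (wave k) ^ \<alpha> * norm (fourier L g k))"
      using w K by (simp add: is_mult_def stokes_symbol_half_nat[OF L k] power_mult_distrib abs_mult)
    ultimately have "kappa0 L ^ \<alpha> * (norm (wave k) ^ \<alpha> * norm (fourier L g k)) \<le> kappa0 L ^ \<alpha> * (D * ?E)"
      by (simp add: D_def mult_ac)
    then show "norm (wave k) ^ \<alpha> * norm (fourier L g k) \<le> D * ?E"
      using K by simp
  qed
  with D show ?thesis by (rule that)
qed

lemma C_class_subset_E_space:
  assumes L: "L > 0" and \<sigma>: "\<sigma> > 0" and b: "b = 1 / (64 * \<sigma>)" and g: "g \<in> C_class L \<nu> \<sigma>"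
  shows "g \<in> E_space L b"
proof -
  obtain D where D: "D \<ge> 0"
    "\<And>k. k \<noteq> 0 \<Longrightarrow> norm (fourier L g k) \<le> D * exp (\<sigma> / 2 - (ln (norm (wave k)))\<^sup>2 / (2 * \<sigma>))"
    using C_class_fourier_bound[OF L \<sigma> g] by blast
  have bpos: "b > 0" using b \<sigma> by simp
  have gH: "g \<in> H_space L" using g by (simp add: C_class_def)
  have g0: "fourier L g 0 = 0" using solenoidal_coeffs_fourier[OF L gH] by (simp add: solenoidal_coeffs_def)
  have "rapid (\<lambda>k. E_symbol b k *\<^sub>R fourier L g k)"
  proof (rule rapid_of_E_bound[OF bpos])
    fix k
    show "E_symbol b k * norm (E_symbol b k *\<^sub>R fourier L g k) \<le> D * exp (\<sigma> / 2 + 1 / (4 * \<sigma>))"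
    proof (cases "k = 0")
      case False
      define l where "l = ln (norm (wave k))"
      have l: "l \<ge> 0" using norm_wave_ge_1[OF False] by (simp add: l_def)
      have "ln (norm (wave k) + exp 1) \<le> l + 2"
        unfolding l_def by (rule ln_plus_exp_1_le[OF norm_wave_ge_1[OF False]])
      moreover have "0 \<le> ln (norm (wave k) + exp 1)"
        using norm_wave_ge_1[OF False] by (intro ln_ge_zero) (simp add: add_increasing2)
      ultimately have "(ln (norm (wave k) + exp 1))\<^sup>2 \<le> (l + 2)\<^sup>2" by (rule power_mono)
      also have "\<dots> \<le> 2 * l\<^sup>2 + 8"
        using sum_squares_bound[of l 2] by (simp add: power2_sum)
      finally have "b * (ln (norm (wave k) + exp 1))\<^sup>2 \<le> b * (2 * l\<^sup>2 + 8)"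
        using bpos by (intro mult_left_mono) auto
      then have E: "E_symbol b k \<le> exp ((l\<^sup>2 + 4) / (32 * \<sigma>))"
        using \<sigma> by (simp add: E_symbol_def b field_simps)
      have "E_symbol b k * norm (E_symbol b k *\<^sub>R fourier L g k) = E_symbol b k * E_symbol b k * norm (fourier L g k)"
        by (simp add: abs_of_pos)
      also have "\<dots> \<le> exp ((l\<^sup>2 + 4) / (32 * \<sigma>)) * exp ((l\<^sup>2 + 4) / (32 * \<sigma>))
          * (D * exp (\<sigma> / 2 - l\<^sup>2 / (2 * \<sigma>)))"
        using E_symbol_pos[of b k] D(2)[OF False]
        by (intro mult_mono E) (auto simp: l_def intro: less_imp_le)
      also have "\<dots> = D * exp ((l\<^sup>2 + 4) / (32 * \<sigma>) + (l\<^sup>2 + 4) / (32 * \<sigma>) + (\<sigma> / 2 - l\<^sup>2 / (2 * \<sigma>)))"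
        unfolding exp_add by simp
      also have "\<dots> \<le> D * exp (\<sigma> / 2 + 1 / (4 * \<sigma>))"
      proof -
        have "(l\<^sup>2 + 4) / (32 * \<sigma>) + (l\<^sup>2 + 4) / (32 * \<sigma>) + (\<sigma> / 2 - l\<^sup>2 / (2 * \<sigma>))
            = \<sigma> / 2 + 1 / (4 * \<sigma>) - 7 * l\<^sup>2 / (16 * \<sigma>)"
          using \<sigma> by (simp add: field_simps)
        also have "\<dots> \<le> \<sigma> / 2 + 1 / (4 * \<sigma>)" using \<sigma> by simp
        finally show ?thesis using D(1) by (intro mult_left_mono) auto
      qed
      finally show ?thesis .
    qed (use D(1) in \<open>simp add: g0\<close>)
  qed
  then have "is_mult L (E_symbol b) g (synth L (\<lambda>k. E_symbol b k *\<^sub>R fourier L g k))"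
    by (intro is_mult_synth L gH) auto
  then have "g \<in> mult_dom L (E_symbol b)" using gH by (auto simp: mult_dom_def)
  then show ?thesis using gH by (simp add: E_space_def E_norm_def)
qed

lemma E_space_eq_Union_E_ball: "E_space L b = (\<Union>n\<in>{1..}. E_ball L b n)"
proof
  show "E_space L b \<subseteq> (\<Union>n\<in>{1..}. E_ball L b n)"
  proof
    fix u assume u: "u \<in> E_space L b"
    then obtain n where "1 \<le> n" "E_norm L b u \<le> of_nat n" by (rule E_norm_le_nat)
    with u show "u \<in> (\<Union>n\<in>{1..}. E_ball L b n)" by (auto simp: E_ball_def)
  qed
qed (auto simp: E_ball_def)

section \<open>The metric on \<open>\<F>\<close> and Baire category\<close>

lemma periodic_shift_int:
  assumes "periodic L f"
  shows "f (x + (of_int n * L) *\<^sub>R axis j 1) = f x"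
proof -
  have nat: "f (x + (real m * L) *\<^sub>R axis j 1) = f x" for m x
  proof (induction m)
    case (Suc m)
    have "x + (real (Suc m) * L) *\<^sub>R axis j 1 = (x + (real m * L) *\<^sub>R axis j 1) + L *\<^sub>R axis j 1"
      by (simp add: algebra_simps)
    then show ?case using Suc assms unfolding periodic_def by metis
  qed simp
  show ?thesis
  proof (cases "n \<ge> 0")
    case True
    then show ?thesis using nat[of x "nat n"] by simp
  next
    case False
    then show ?thesis using nat[of "x + (of_int n * L) *\<^sub>R axis j 1" "nat (- n)"] by simp
  qed
qed

lemma periodic_representative:
  assumes L: "L > 0" and per: "periodic L f"
  obtains y where "y \<in> Omega L" "f y = f x"
proof -
  define n where "n j = - \<lfloor>x $ j / L\<rfloor>" for j
  define y where "y = (x + (of_int (n 1) * L) *\<^sub>R axis 1 1) + (of_int (n 2) * L) *\<^sub>R axis 2 1"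
  have "y $ j = x $ j + of_int (n j) * L" for j
    using exhaust_2[of j] by (auto simp: y_def axis_def)
  moreover have "0 \<le> x $ j + of_int (n j) * L \<and> x $ j + of_int (n j) * L \<le> L" for j
  proof -
    have "of_int \<lfloor>x $ j / L\<rfloor> * L \<le> x $ j"
      using L by (simp flip: pos_le_divide_eq)
    moreover have "x $ j \<le> (of_int \<lfloor>x $ j / L\<rfloor> + 1) * L"
      using L by (simp flip: pos_divide_le_eq)
    ultimately show ?thesis by (simp add: n_def algebra_simps)
  qed
  ultimately have "y \<in> Omega L" by (simp add: Omega_def)
  moreover have "f y = f x" unfolding y_def by (simp only: periodic_shift_int[OF per])
  ultimately show ?thesis by (rule that)
qed

lemma continuous_periodic_AE_eq_0:
  fixes f :: "real^2 \<Rightarrow> 'b :: real_normed_vector"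
  assumes L: "L > 0" and per: "periodic L f" and cont: "continuous_on UNIV f"
    and ae: "AE x in lebesgue_on (Omega L). f x = 0"
  shows "f x = 0"
proof -
  let ?B = "box 0 (\<chi> j. L) :: (real^2) set"
  have sub: "?B \<subseteq> Omega L" unfolding Omega_eq_cbox by (rule box_subset_cbox)
  have "AE x in lebesgue. x \<in> Omega L \<longrightarrow> f x = 0"
    using ae by (simp add: AE_restrict_space_iff)
  then obtain N where N: "\<And>x. x \<in> space lebesgue - N \<Longrightarrow> x \<in> Omega L \<longrightarrow> f x = 0" "N \<in> null_sets lebesgue"
    by (rule AE_E3) auto
  have "open (?B \<inter> f -` (- {0}))"
    using cont by (intro open_Int open_box continuous_open_vimage) (auto simp: continuous_on_eq_continuous_within)
  moreover have "negligible (?B \<inter> f -` (- {0}))"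
    by (rule negligible_subset[of N]) (use N sub in \<open>auto simp: negligible_iff_null_sets\<close>)
  ultimately have "?B \<inter> f -` (- {0}) = {}" using open_not_negligible by blast
  then have zero: "f y = 0" if "y \<in> ?B" for y using that by auto
  have ne: "?B \<noteq> {}" using L by (simp add: interval_ne_empty_cart)
  obtain y where y: "y \<in> Omega L" "f y = f x" using periodic_representative[OF L per] .
  have "f y = 0"
  proof (rule continuous_constant_on_closure[of ?B])
    show "continuous_on (closure ?B) f" using cont continuous_on_subset by blast
    show "y \<in> closure ?B" using y ne by (simp add: closure_box Omega_eq_cbox)
  qed (rule zero)
  with y show ?thesis by simp
qed

lemma F_space_add: "L > 0 \<Longrightarrow> u \<in> F_space L \<Longrightarrow> v \<in> F_space L \<Longrightarrow> (\<lambda>x. u x + v x) \<in> F_space L"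
  by (simp add: F_space_def H_space_add smooth_add periodic_add)

lemma F_space_scaleR: "L > 0 \<Longrightarrow> u \<in> F_space L \<Longrightarrow> (\<lambda>x. r *\<^sub>R u x) \<in> F_space L"
  by (simp add: F_space_def H_space_scaleR smooth_scaleR periodic_def)

lemma F_space_diff: "L > 0 \<Longrightarrow> u \<in> F_space L \<Longrightarrow> v \<in> F_space L \<Longrightarrow> (\<lambda>x. u x - v x) \<in> F_space L"
  using F_space_add[of L u "\<lambda>x. (-1) *\<^sub>R v x"] F_space_scaleR[of L v "-1"] by simp

lemma F_space_L2: "u \<in> F_space L \<Longrightarrow> u \<in> L2_space L"
  by (simp add: F_space_def H_space_L2)

lemma stokes_pow_F_space:
  assumes "L > 0" "u \<in> F_space L"
  shows "stokes_pow L (real \<alpha> / 2) u \<in> H_space L"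
    and "fourier L (stokes_pow L (real \<alpha> / 2) u) k = stokes_symbol L (real \<alpha> / 2) k *\<^sub>R fourier L u k"
  using is_mult_stokes_pow[OF assms, of \<alpha>] by (auto simp: is_mult_def)

lemma stokes_norm_triangle:
  assumes L: "L > 0" and uv: "u \<in> F_space L" "v \<in> F_space L"
  shows "L2_norm L (stokes_pow L (real \<alpha> / 2) (\<lambda>x. u x + v x))
    \<le> L2_norm L (stokes_pow L (real \<alpha> / 2) u) + L2_norm L (stokes_pow L (real \<alpha> / 2) v)"
proof -
  let ?A = "stokes_pow L (real \<alpha> / 2)"
  note H = stokes_pow_F_space[OF L]
  have "L2_norm L (?A (\<lambda>x. u x + v x)) = L2_norm L (\<lambda>x. ?A u x + ?A v x)"
  proof (rule H_space_L2_norm_cong[OF L])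
    show "?A (\<lambda>x. u x + v x) \<in> H_space L" by (intro H F_space_add L uv)
    show "(\<lambda>x. ?A u x + ?A v x) \<in> H_space L" by (intro H_space_add L H uv)
    show "fourier L (?A (\<lambda>x. u x + v x)) k = fourier L (\<lambda>x. ?A u x + ?A v x) k" for k
      using uv by (simp add: H F_space_add L fourier_add F_space_L2 H_space_L2 scaleR_add_right)
  qed
  also have "\<dots> \<le> L2_norm L (?A u) + L2_norm L (?A v)"
    by (intro L2_norm_triangle H_space_L2 H uv)
  finally show ?thesis .
qed

lemma stokes_norm_scaleR:
  assumes L: "L > 0" and u: "u \<in> F_space L"
  shows "L2_norm L (stokes_pow L (real \<alpha> / 2) (\<lambda>x. r *\<^sub>R u x)) = \<bar>r\<bar> * L2_norm L (stokes_pow L (real \<alpha> / 2) u)"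
proof -
  let ?A = "stokes_pow L (real \<alpha> / 2)"
  note H = stokes_pow_F_space[OF L]
  have "L2_norm L (?A (\<lambda>x. r *\<^sub>R u x)) = L2_norm L (\<lambda>x. r *\<^sub>R ?A u x)"
  proof (rule H_space_L2_norm_cong[OF L])
    show "?A (\<lambda>x. r *\<^sub>R u x) \<in> H_space L" by (intro H F_space_scaleR L u)
    show "(\<lambda>x. r *\<^sub>R ?A u x) \<in> H_space L" by (intro H_space_scaleR L H u)
    show "fourier L (?A (\<lambda>x. r *\<^sub>R u x)) k = fourier L (\<lambda>x. r *\<^sub>R ?A u x) k" for k
      using u by (simp add: H F_space_scaleR L fourier_scaleR)
  qed
  then show ?thesis by (simp add: L2_norm_scaleR)
qed

text \<open>Outside its domain \<open>mult_op\<close> picks an arbitrary function, but the same one for \<open>f\<close> and \<open>- f\<close>;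
  hence \<open>F_dist\<close> is symmetric on all functions, as \<open>Metric_space\<close> demands.\<close>

lemma L2_norm_mult_op_minus:
  assumes L: "L > 0"
  shows "L2_norm L (mult_op L m (\<lambda>x. - f x)) = L2_norm L (mult_op L m f)"
proof (cases "\<exists>w. is_mult L m f w")
  case True
  then have w: "is_mult L m f (mult_op L m f)" using is_mult_mult_op by blast
  then have w': "is_mult L m (\<lambda>x. - f x) (\<lambda>x. - mult_op L m f x)"
    by (simp add: is_mult_def H_space_minus L fourier_minus)
  then have "is_mult L m (\<lambda>x. - f x) (mult_op L m (\<lambda>x. - f x))" by (rule is_mult_mult_op)
  with w' have "L2_norm L (mult_op L m (\<lambda>x. - f x)) = L2_norm L (\<lambda>x. - mult_op L m f x)"
    by (intro H_space_L2_norm_cong L) (auto simp: is_mult_def)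
  then show ?thesis by (simp add: L2_norm_minus)
next
  case False
  have "\<not> is_mult L m (\<lambda>x. - f x) w" for w
  proof
    assume "is_mult L m (\<lambda>x. - f x) w"
    then have "is_mult L m f (\<lambda>x. - w x)"
      by (simp add: is_mult_def H_space_minus L fourier_minus)
    with False show False by blast
  qed
  with False have "is_mult L m f = is_mult L m (\<lambda>x. - f x)" by blast
  then show ?thesis by (simp add: mult_op_def)
qed

lemma F_term_nonneg [simp]: "0 \<le> F_term L \<alpha> u v"
  by (simp add: F_term_def)

lemma F_term_commute: "L > 0 \<Longrightarrow> F_term L \<alpha> u v = F_term L \<alpha> v u"
  using L2_norm_mult_op_minus[of L _ "\<lambda>x. u x - v x"] by (simp add: F_term_def stokes_pow_def)

lemma F_term_triangle:
  assumes "L > 0" "u \<in> F_space L" "v \<in> F_space L" "w \<in> F_space L"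
  shows "F_term L \<alpha> u w \<le> F_term L \<alpha> u v + F_term L \<alpha> v w"
  using stokes_norm_triangle[OF assms(1) F_space_diff[OF assms(1,2,3)] F_space_diff[OF assms(1,3,4)], of \<alpha>]
  by (simp add: F_term_def)

lemma F_term_self:
  assumes "L > 0" "u \<in> F_space L"
  shows "F_term L \<alpha> u u = 0"
  using stokes_norm_scaleR[OF assms, of \<alpha> 0] by (simp add: F_term_def)

lemma F_term_add_scaleR:
  assumes "L > 0" "w \<in> F_space L"
  shows "F_term L \<alpha> u (\<lambda>x. u x + t *\<^sub>R w x) = \<bar>t\<bar> * L2_norm L (stokes_pow L (real \<alpha> / 2) w)"
  using stokes_norm_scaleR[OF assms, of \<alpha> "- t"] by (simp add: F_term_def)

lemma fourier_le_F_term: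
  assumes L: "L > 0" and uv: "u \<in> F_space L" "v \<in> F_space L"
  shows "norm (fourier L u k - fourier L v k) \<le> 2 / (L * kappa0 L) * F_term L 1 u v"
proof (cases "k = 0")
  case True
  have "fourier L u 0 = 0" "fourier L v 0 = 0"
    using uv solenoidal_coeffs_fourier[OF L] by (auto simp: F_space_def solenoidal_coeffs_def)
  then show ?thesis using True L kappa0_pos[OF L]
    by (auto intro!: divide_nonneg_pos mult_pos_pos)
next
  case False
  note d = F_space_diff[OF L uv]
  let ?w = "stokes_pow L (real 1 / 2) (\<lambda>x. u x - v x)"
  note K = kappa0_pos[OF L]
  have "kappa0 L * norm (fourier L u k - fourier L v k)
      \<le> kappa0 L * norm (wave k) * norm (fourier L u k - fourier L v k)"
    using K norm_wave_ge_1[OF False] by (intro mult_right_mono) auto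
  also have "\<dots> = norm (fourier L ?w k)"
    using K uv unfolding stokes_pow_F_space(2)[OF L d] stokes_symbol_half_nat[OF L False]
    by (simp add: fourier_diff F_space_L2 abs_mult)
  also have "\<dots> \<le> 2 * L2_norm L ?w / L"
    by (intro norm_fourier_le L H_space_L2 stokes_pow_F_space d)
  finally show ?thesis
    using K L by (simp add: F_term_def field_simps)
qed

lemma frac_one_plus_mono: "0 \<le> x \<Longrightarrow> x \<le> y \<Longrightarrow> x / (1 + x) \<le> y / (1 + y)" for x y :: real
  by (simp add: field_simps)

lemma frac_one_plus_add_le:
  fixes x y :: real
  assumes "0 \<le> x" "0 \<le> y"
  shows "(x + y) / (1 + (x + y)) \<le> x / (1 + x) + y / (1 + y)"
proof -
  have "(x + y) / (1 + (x + y)) = x / (1 + (x + y)) + y / (1 + (x + y))" by (simp add: add_divide_distrib)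
  also have "\<dots> \<le> x / (1 + x) + y / (1 + y)"
    using assms by (intro add_mono divide_left_mono) auto
  finally show ?thesis .
qed

lemma mult_frac_one_plus_le:
  fixes p x :: real
  assumes "0 \<le> p" "0 \<le> x"
  shows "p * (x / (1 + x)) \<le> p"
  using assms by (intro mult_left_le) (auto simp: pos_divide_le_eq add_pos_nonneg)

lemma F_dist_summand_bounds:
  "0 \<le> (1/2) ^ Suc n * (F_term L \<alpha> u v / (1 + F_term L \<alpha> u v))"
  "(1/2) ^ Suc n * (F_term L \<alpha> u v / (1 + F_term L \<alpha> u v)) \<le> (1/2) ^ Suc n"
  by (simp, rule mult_frac_one_plus_le) auto

lemma summable_half_power_Suc: "summable (\<lambda>n. (1/2::real) ^ Suc n)"
  using summable_geometric[of "1/2::real"] by (simp add: summable_mult)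

lemma summable_F_dist: "summable (\<lambda>n. (1/2) ^ Suc n * (F_term L (Suc n) u v / (1 + F_term L (Suc n) u v)))"
  using F_dist_summand_bounds
  by (intro summable_comparison_test'[OF summable_half_power_Suc]) (simp del: power_Suc)

lemma F_term_1_le_F_dist:
  "1/2 * (F_term L 1 u v / (1 + F_term L 1 u v)) \<le> F_dist L u v"
  using sum_le_suminf[OF summable_F_dist[of L u v], of "{0}"] F_dist_summand_bounds
  by (simp add: F_dist_def del: power_Suc) 

lemma F_term_1_le_of_F_dist_less:
  assumes "F_dist L u v < 1/4"
  shows "F_term L 1 u v \<le> 4 * F_dist L u v"
proof -
  let ?a = "F_term L 1 u v" and ?d = "F_dist L u v"
  have "?a / (1 + ?a) \<le> 2 * ?d" using F_term_1_le_F_dist[of L u v] by linarith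
  moreover have a: "0 < 1 + ?a" using F_term_nonneg[of L 1 u v] by linarith
  ultimately have "?a \<le> 2 * ?d * (1 + ?a)" by (simp add: pos_divide_le_eq)
  moreover have "2 * ?d * ?a \<le> 1/2 * ?a" using assms by (intro mult_right_mono) auto
  ultimately show ?thesis by (simp add: algebra_simps)
qed

lemma Metric_space_F:
  assumes L: "L > 0"
  shows "Metric_space (F_space L) (F_dist L)"
proof
  show "0 \<le> F_dist L u v" for u v
    unfolding F_dist_def by (intro suminf_nonneg summable_F_dist F_dist_summand_bounds)
  show "F_dist L u v = F_dist L v u" for u v
    by (simp add: F_dist_def F_term_commute[OF L, of _ u v])
next
  fix u v assume uv: "u \<in> F_space L" "v \<in> F_space L"
  show "F_dist L u v = 0 \<longleftrightarrow> u = v"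
  proof
    assume "F_dist L u v = 0"
    then have "F_term L 1 u v \<le> 0" using F_term_1_le_of_F_dist_less[of L u v] by simp
    then have F0: "F_term L 1 u v = 0" using F_term_nonneg[of L 1 u v] by linarith
    have "fourier L u k = fourier L v k" for k
      using fourier_le_F_term[OF L uv, of k] unfolding F0 by simp
    then have ae: "L2_eq L u v"
      using uv by (intro H_space_L2_eqI L) (auto simp: F_space_def)
    show "u = v"
    proof
      fix x
      have "u x - v x = 0"
      proof (rule continuous_periodic_AE_eq_0[OF L, where f = "\<lambda>x. u x - v x"])
        show "AE x in lebesgue_on (Omega L). u x - v x = 0" using ae by (simp add: L2_eq_def)
      qed (use F_space_diff[OF L uv] in \<open>auto simp: F_space_def intro: smooth_continuous\<close>)
      then show "u x = v x" by simp
    qed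
  next
    assume "u = v"
    then show "F_dist L u v = 0" using uv by (simp add: F_dist_def F_term_self L)
  qed
next
  fix u v w assume uvw: "u \<in> F_space L" "v \<in> F_space L" "w \<in> F_space L"
  let ?f = "\<lambda>u v n. (1/2) ^ Suc n * (F_term L (Suc n) u v / (1 + F_term L (Suc n) u v))"
  have "F_dist L u w \<le> (\<Sum>n. ?f u v n + ?f v w n)"
    unfolding F_dist_def
  proof (intro suminf_le summable_add summable_F_dist)
    fix n
    let ?t = "F_term L (Suc n)"
    have "?t u w / (1 + ?t u w) \<le> (?t u v + ?t v w) / (1 + (?t u v + ?t v w))"
      by (intro frac_one_plus_mono F_term_triangle L uvw) simp
    also have "\<dots> \<le> ?t u v / (1 + ?t u v) + ?t v w / (1 + ?t v w)"
      by (intro frac_one_plus_add_le) auto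
    finally show "?f u w n \<le> ?f u v n + ?f v w n"
      unfolding distrib_left[symmetric] by (intro mult_left_mono) auto
  qed
  also have "\<dots> = F_dist L u v + F_dist L v w"
    unfolding F_dist_def by (rule suminf_add[symmetric]; rule summable_F_dist)
  finally show "F_dist L u w \<le> F_dist L u v + F_dist L v w" .
qed

lemma F_dist_add_scaleR_tendsto_0:
  assumes L: "L > 0" and w: "w \<in> F_space L"
  shows "((\<lambda>t. F_dist L u (\<lambda>x. u x + t *\<^sub>R w x)) \<longlongrightarrow> 0) (at_right 0)"
proof -
  define P where "P n = L2_norm L (stokes_pow L (real (Suc n) / 2) w)" for n
  define a where "a n t = (1/2) ^ Suc n * (\<bar>t\<bar> * P n / (1 + \<bar>t\<bar> * P n))" for n and t :: real
  have F: "F_dist L u (\<lambda>x. u x + t *\<^sub>R w x) = suminf (\<lambda>n. a n t)" for t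
    by (simp only: F_dist_def F_term_add_scaleR[OF L w] a_def P_def)
  have "((\<lambda>t. suminf (\<lambda>n. a n t)) \<longlongrightarrow> suminf (\<lambda>n. 0 :: real)) (at_right 0)"
  proof (rule conjunct2[OF conjunct2[OF tannerys_theorem]])
    show "((\<lambda>t. a n t) \<longlongrightarrow> 0) (at_right 0)" for n
      unfolding a_def by (auto intro!: tendsto_eq_intros)
    have "norm (a n t) \<le> (1/2) ^ Suc n" for n t
    proof -
      have "P n \<ge> 0" by (simp add: P_def)
      then have "0 \<le> a n t" "a n t \<le> (1/2) ^ Suc n"
        unfolding a_def by (simp, intro mult_frac_one_plus_le) auto
      then show ?thesis by simp
    qed
    then show "\<forall>\<^sub>F (n, t) in at_top \<times>\<^sub>F at_right 0. norm (a n t) \<le> (1/2) ^ Suc n"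
      by (intro always_eventually) auto
  qed (auto intro: summable_half_power_Suc)
  then show ?thesis by (simp add: F)
qed

text \<open>The witness has the coefficients \<open>i k\<^sup>\<bottom> / m(k)\<close>, where \<open>k\<^sup>\<bottom> = (- k\<^sub>2, k\<^sub>1)\<close> and \<open>m\<close> is the
  symbol of \<open>E\<^sup>b\<close>.\<close>

lemma exists_F_space_E_unbounded:
  assumes L: "L > 0" and b: "b > 0"
  obtains w where "w \<in> F_space L" "\<And>B. \<exists>k. B < E_symbol b k * norm (fourier L w k)"
proof -
  define c :: "int^2 \<Rightarrow> complex^2" where
    "c k = (\<chi> j. \<i> * of_int (if j = 1 then - (k $ 2) else k $ 1) / of_real (E_symbol b k))" for k
  have norm_axis: "norm (axis 1 1 :: complex^2) = 1"
    by (simp add: norm_vec_def L2_set_def sum_2 axis_def)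
  have base: "rapid (\<lambda>k. (1 / E_symbol b k) *\<^sub>R axis 1 1)"
    by (rule rapid_of_E_bound[OF b, where B = 1]) (simp add: norm_axis abs_of_pos)
  have c: "rapid c"
  proof (rule rapid_bounded_by[OF base])
    fix k
    have "norm (c k) \<le> norm (c k $ 1) + norm (c k $ 2)"
      unfolding norm_vec_def by (rule order_trans[OF L2_set_le_sum]) (auto simp: sum_2)
    also have "\<dots> = (\<bar>of_int (k $ 2)\<bar> + \<bar>of_int (k $ 1)\<bar>) / E_symbol b k"
      by (simp add: c_def norm_mult norm_divide abs_of_pos add_divide_distrib)
    also have "\<dots> \<le> (2 * (1 + norm (wave k))) / E_symbol b k"
      using component_le_norm_wave[of k 1] component_le_norm_wave[of k 2]
      by (intro divide_right_mono) (auto intro: less_imp_le)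
    finally show "norm (c k) \<le> 2 * (1 + norm (wave k)) ^ 1 * norm ((1 / E_symbol b k) *\<^sub>R (axis 1 1 :: complex^2))"
      by (simp add: norm_axis abs_of_pos)
  qed simp
  have sol: "solenoidal_coeffs c"
    unfolding solenoidal_coeffs_def
    by (auto simp: c_def sum_2 vec_eq_iff)
  show ?thesis
  proof (rule that)
    show "synth L c \<in> F_space L" by (rule synth_F_space[OF L c sol])
    fix B :: real
    obtain N :: nat where N: "B < real N" using reals_Archimedean2 by blast
    define k :: "int^2" where "k = (\<chi> j. if j = 1 then int N else 0)"
    have "B < E_symbol b k * norm (c k $ 2)"
      using N less_imp_neq[OF E_symbol_pos[of b k]] by (simp add: c_def k_def norm_divide norm_mult abs_of_pos)
    also have "\<dots> \<le> E_symbol b k * norm (c k)"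
      by (intro mult_left_mono Finite_Cartesian_Product.norm_nth_le) (auto intro: less_imp_le)
    finally show "\<exists>k. B < E_symbol b k * norm (fourier L (synth L c) k)"
      by (auto simp: fourier_synth[OF L c sol])
  qed
qed

lemma nowhere_dense_E_ball:
  assumes L: "L > 0" and b: "b > 0"
  shows "nowhere_dense_in (Metric_space.mtopology (F_space L) (F_dist L)) (E_ball L b n \<inter> F_space L)"
proof -
  interpret F: Metric_space "F_space L" "F_dist L" by (rule Metric_space_F[OF L])
  let ?T = "E_ball L b n \<inter> F_space L" and ?E = "E_symbol b" and ?R = "2 * real n / L"
  have ball: "?E k * norm (fourier L y k) \<le> ?R" if "y \<in> ?T" for y k
    using that by (intro E_norm_bound L) (auto simp: E_ball_def ennreal_of_nat_eq_real_of_nat)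
  have closure: "?E k * norm (fourier L x k) \<le> ?R" if x: "x \<in> F.mtopology closure_of ?T" for x k
  proof (rule field_le_epsilon)
    fix e :: real assume e: "e > 0"
    have xF: "x \<in> F_space L" using x by (simp add: F.metric_closure_of)
    define C where "C = 2 / (L * kappa0 L)"
    have C: "C > 0" using L kappa0_pos[OF L] by (simp add: C_def)
    define \<delta> where "\<delta> = min (1/4) (e / (4 * C * ?E k))"
    have "\<delta> > 0" using e C by (simp add: \<delta>_def)
    then obtain y where y: "y \<in> ?T" "F_dist L x y < \<delta>"
      using x by (auto simp: F.metric_closure_of)
    have "norm (fourier L x k - fourier L y k) \<le> C * F_term L 1 x y"
      unfolding C_def using y xF by (intro fourier_le_F_term L) auto
    also have "\<dots> \<le> C * (4 * F_dist L x y)"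
      using y C by (intro mult_left_mono F_term_1_le_of_F_dist_less) (auto simp: \<delta>_def)
    also have "\<dots> \<le> C * (4 * (e / (4 * C * ?E k)))"
      using y C by (intro mult_left_mono) (auto simp: \<delta>_def)
    also have "\<dots> = e / ?E k" using C by simp
    finally have "?E k * norm (fourier L x k - fourier L y k) \<le> e"
      by (simp add: pos_le_divide_eq mult.commute)
    moreover have "?E k * norm (fourier L x k) \<le> ?E k * norm (fourier L y k) + ?E k * norm (fourier L x k - fourier L y k)"
      unfolding distrib_left[symmetric]
      by (intro mult_left_mono norm_triangle_sub) (auto intro: less_imp_le)
    ultimately show "?E k * norm (fourier L x k) \<le> ?R + e" using ball[OF y(1), of k] by linarith
  qed
  have "F.mtopology interior_of (F.mtopology closure_of ?T) = {}"
  proof (rule ccontr)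
    assume "\<not> ?thesis"
    then obtain u r where u: "u \<in> F_space L" and r: "r > 0" "F.mball u r \<subseteq> F.mtopology closure_of ?T"
      by (auto simp: F.metric_interior_of)
    obtain w where w: "w \<in> F_space L" "\<And>B. \<exists>k. B < ?E k * norm (fourier L w k)"
      using exists_F_space_E_unbounded[OF L b] by blast
    let ?v = "\<lambda>t x. u x + t *\<^sub>R w x"
    have "eventually (\<lambda>t. F_dist L u (?v t) < r \<and> 0 < t) (at_right 0)"
      by (intro eventually_conj order_tendstoD(2)[OF F_dist_add_scaleR_tendsto_0[OF L w(1)] r(1)]
          eventually_at_right_less)
    then obtain t where t: "F_dist L u (?v t) < r" "0 < t"
      using eventually_happens'[OF trivial_limit_at_right_real] by blast
    have vF: "?v t \<in> F_space L" by (intro F_space_add F_space_scaleR L u w)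
    have fv: "fourier L (?v t) k = fourier L u k + t *\<^sub>R fourier L w k" for k
      using fourier_add[OF F_space_L2[OF u] F_space_L2[OF F_space_scaleR[OF L w(1)]]] 
      by (simp add: fourier_scaleR)
    have bound: "?E k * norm (fourier L w k) \<le> 2 * ?R / t" for k
    proof -
      have uc: "?E k * norm (fourier L u k) \<le> ?R"
        by (rule closure) (use r u in auto)
      have vc: "?E k * norm (fourier L (?v t) k) \<le> ?R"
        by (rule closure) (use r u vF t in auto)
      have "t * norm (fourier L w k) = norm (fourier L (?v t) k - fourier L u k)"
        using t by (simp add: fv)
      also have "\<dots> \<le> norm (fourier L (?v t) k) + norm (fourier L u k)" by (rule norm_triangle_ineq4)
      finally have "?E k * (t * norm (fourier L w k)) \<le> ?E k * (norm (fourier L (?v t) k) + norm (fourier L u k))"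
        by (intro mult_left_mono) (auto intro: less_imp_le)
      also have "\<dots> \<le> 2 * ?R" using uc vc unfolding distrib_left by linarith
      finally have "?E k * norm (fourier L w k) * t \<le> 2 * ?R" by (simp add: mult_ac)
      then show ?thesis by (subst pos_le_divide_eq[OF t(2)])
    qed
    obtain k where "2 * ?R / t < ?E k * norm (fourier L w k)" using w(2) by blast
    with bound[of k] show False by simp
  qed
  then show ?thesis by (simp add: nowhere_dense_in_def)
qed

lemma first_category_E_space:
  assumes L: "L > 0" and b: "b > 0"
  shows "first_category_in (Metric_space.mtopology (F_space L) (F_dist L)) (E_space L b \<inter> F_space L)"
  unfolding first_category_in_def
proof (intro exI conjI ballI)
  let ?G = "(\<lambda>n. E_ball L b n \<inter> F_space L) ` {1..}"
  show "countable ?G" by simp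
  show "E_space L b \<inter> F_space L = \<Union> ?G" by (subst E_space_eq_Union_E_ball) auto
  show "nowhere_dense_in (Metric_space.mtopology (F_space L) (F_dist L)) T" if "T \<in> ?G" for T
    using that nowhere_dense_E_ball[OF L b] by auto
qed

theorem theorem6p3:
  fixes L \<nu> \<beta>3 b :: real and g :: "real^2 \<Rightarrow> real^2"
  assumes "L > 0" and "\<nu> > 0"
    and "g \<in> H_space L"
    and "\<beta>3 > 1"
    and "(\<lambda>x. 0) \<in> attractor L \<nu> g \<Longrightarrow> g \<in> C_class L \<nu> (5 / 2 * ln \<beta>3)"
    and "b = 1 / (160 * ln \<beta>3)"
    and "(\<lambda>x. 0) \<in> attractor L \<nu> g"
  shows "g \<in> E_space L b
    \<and> E_space L b = (\<Union>n\<in>{1..}. E_ball L b n)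
    \<and> (\<forall>u\<in>E_space L b. \<exists>w\<in>F_space L. L2_eq L u w)
    \<and> first_category_in (Metric_space.mtopology (F_space L) (F_dist L)) (E_space L b \<inter> F_space L)"
proof (intro conjI ballI)
  have ln: "ln \<beta>3 > 0" using assms(4) by simp
  then have b: "b > 0" using assms(6) by simp
  show "g \<in> E_space L b"
  proof (rule C_class_subset_E_space[OF assms(1)])
    show "g \<in> C_class L \<nu> (5 / 2 * ln \<beta>3)" by (rule assms(5)[OF assms(7)])
  qed (use ln assms(6) in auto)
  show "E_space L b = (\<Union>n\<in>{1..}. E_ball L b n)" by (rule E_space_eq_Union_E_ball)
  show "\<exists>w\<in>F_space L. L2_eq L u w" if "u \<in> E_space L b" for u
    using E_space_F_space_representative[OF assms(1) b that] .
  show "first_category_in (Metric_space.mtopology (F_space L) (F_dist L)) (E_space L b \<inter> F_space L)"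
    by (rule first_category_E_space[OF assms(1) b])
qed

end
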